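(* Consider a ferromagnetic ERGM specification $(G_j,\beta_j)_{0\le j\le K}$ and $p\in U_\beta$. Let $\varepsilon>0$ be sufficiently small (depending on the specification and $p$), and let $\eta,\gamma>0$ and the sets $\Lambda^*=\Lambda^*_n$ be as described in the context for this $\varepsilon$. Let $(X_t^x)$ denote the Glauber dynamics conditioned on $\mathcal B_p^\eta$ started at $X_0^x=x$, with all chains coupled by the monotone coupling. There is some constant $C>0$ such that the following holds for all sufficiently large $n$. Let $v\in[n]$ and $e\in\binom{[n]}2$ with $v\notin e$. Suppose that $x\in\Lambda^*$, and set $x'=x^{\oplus e}$. Then for all $t\ge0$, $$\mathbb E\left[\mathbf d_{\mathrm{Ham}}^{\mathrm{loc}(v)}(X_t^x,X_t^{x'})\right]\le\frac Cn .$$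
   Context: Graphs are finite and simple. $\binom{[n]}{2}$ is the set of potential edges on $[n]=\{1,\dots,n\}$; for a graph $x$ on $[n]$, $x(e)\in\{0,1\}$ indicates whether $e$ is present; $x^{+e},x^{-e}$ are $x$ with $e$ made present/absent; $x^{\oplus e}$ is $x$ with the status of $e$ flipped; $\partial_e f(x)=f(x^{+e})-f(x^{-e})$. Hamming distance: $\mathbf d_{\mathrm{Ham}}(x,x')=\sum_{e}|x(e)-x'(e)|$; local Hamming distance: $\mathbf d_{\mathrm{Ham}}^{\mathrm{loc}(v)}(x,x')=\sum_{e\ni v}|x(e)-x'(e)|$. For a fixed graph $G=(\mathcal V,\mathcal E)$, $\mathsf{N}_G(x)$ is the number of maps $\mathcal V\to[n]$ (not necessarily injective) sending every edge of $G$ to an edge of $x$, $\mathsf{t}(G,x)=\mathsf{N}_G(x)/n^{|\mathcal V|}$, and $\mathsf N_G(x,e)=\partial_e\mathsf N_G(x)$. Ferromagnetic ERGM specification: fixed graphs $G_0,\dots,G_K$, $G_j=(\mathcal V_j,\mathcal E_j)$, $\mathsf v_j=|\mathcal V_j|$, $\mathsf e_j=|\mathcal E_j|$, where $G_0$ is a single edge, and fixed parameters $\beta_0\in\mathbb R$, $\beta_1,\dots,\beta_K\ge 0$. $\mathsf H(x)=\sum_{j=0}^K\beta_j\,\mathsf t(G_j,x)$. For $q\in[0,1]$: $\mathsf H(q)=\sum_j\beta_j q^{\mathsf e_j}$, $I(q)=\frac12 q\log q+\frac12(1-q)\log(1-q)$, $L_\beta(q)=\mathsf H(q)-I(q)$.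 $M_\beta$ is the set of global maximizers of $L_\beta$ on $[0,1]$ and $U_\beta=\{q\in M_\beta: L_\beta''(q)<0\}$. Conditioned measure: a graphon is a symmetric measurable function $[0,1]^2\to[0,1]$. A graph $x$ on $[n]$ with adjacency matrix $(a_{ij})$ is represented by $W_x(s,t)=a_{ij}$ for $s\in(\frac{i-1}n,\frac in)$, $t\in(\frac{j-1}n,\frac jn)$; $W_p$ is the constant graphon $p$. $\mathbf d_\square(W,W')=\inf_\sigma\sup_{S,T\subseteq[0,1]}\left|\int_S\int_T W(\sigma(s),\sigma(t))-W'(s,t)\,ds\,dt\right|$, $\sigma$ ranging over measure-preserving bijections of $[0,1]$ and $S,T$ over measurable sets. $\mathcal B_p^\eta=\{W:\mathbf d_\square(W,W_p)<\eta\}$; a graph $x$ is said to lie in $\mathcal B_p^\eta$ if $W_x$ does. $\mu^\eta_{\mathsf H}(n,p)$ is the law with $\mathbb P[X=x]\propto e^{n^2\mathsf H(x)}\mathbf 1\{W_x\in\mathcal B_p^\eta\}$. Conditioned Glauber dynamics $(X_t^x)$, $x\in\mathcal B_p^\eta$: at each step choose $e\in\binom{[n]}2$ uniformly; from the current state $y$ propose $y^{+e}$ with probability $\phi(n^2\partial_e\mathsf H(y))$, $\phi(z)=\frac{e^z}{1+e^z}$, and $y^{-e}$ otherwise; move to the proposal if it lies in $\mathcal B_p^\eta$, else stay at $y$. Monotone coupling: all chains use the same $e$ and the same uniform $[0,1]$ variable $u$ at each step, proposing to include $e$ iff $u\le\phi(n^2\partial_e\mathsf H(\cdot))$. Good set: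 for a graph $G=(\mathcal V,\mathcal E)$ with $|\mathcal E|>1$, $\mathsf r_G(x,e)=\left(\frac{\mathsf N_G(x,e)}{2|\mathcal E|n^{|\mathcal V|-2}}\right)^{1/(|\mathcal E|-1)}$, and $\Gamma_p^\varepsilon$ is the set of graphs $x$ on $[n]$ with $|\mathsf r_G(x,e)-p|<\varepsilon$ for all $e\in\binom{[n]}2$ and all $G$ with $|\mathcal V|\le\max_j\mathsf v_j$, $|\mathcal E|>1$. The set $\Lambda^*$ (known fact): for $p\in U_\beta$ and all small enough $\varepsilon>0$ there are $\eta,\gamma>0$ such that for all large enough $n$ there is a set $\Lambda^*\subseteq\mathcal B_p^\eta$ of graphs on $[n]$ such that, with $X\sim\mu_{\mathsf H}^\eta(n,p)$: (I) $\mathbb P[X\in\Lambda^*]\ge1-e^{-\gamma n}$; (II) whenever $\mathbf d_{\mathrm{Ham}}(x,\Lambda^* )\le1$, $\mathbb P[X_t^x\in\Gamma_p^\varepsilon\cap\mathcal B_p^{\eta/2}\text{ for all }t<e^{\gamma n}]\ge1-e^{-\gamma n}$; (III) $\Lambda^*$ is connected under the relation $\mathbf d_{\mathrm{Ham}}(x,x')=1$, and any two points of $\Lambda^*$ are joined by a nearest-neighbour path inside $\Lambda^*$ of length at most $2n^2$. Fix such $\eta,\gamma,\Lambda^*$. The constant $C$ does not depend on $n,v,e,x,t$. *)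

theory Defs
  imports "HOL-Probability.Probability" "HOL-Library.Ramsey"
begin

section \<open>Graphs\<close>

text \<open>
  A finite simple graph is a pair of a vertex set and an edge set. All notions below are invariant
  under graph isomorphism, so taking vertices in \<^typ>\<open>nat\<close> is no restriction.
\<close>
type_synonym fgraph = "nat set \<times> nat set set"

definition simple_graph :: "fgraph \<Rightarrow> bool" where
  "simple_graph G \<longleftrightarrow> finite (fst G) \<and> snd G \<subseteq> [fst G]\<^bsup>2\<^esup>"

abbreviation nverts :: "fgraph \<Rightarrow> nat" where "nverts G \<equiv> card (fst G)"
abbreviation nedges :: "fgraph \<Rightarrow> nat" where "nedges G \<equiv> card (snd G)"

text \<open>A graph on \<open>[n] = {1..n}\<close> is identified with its edge set.\<close>
type_synonym ngraph = "nat set set"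

definition pot_edges :: "nat \<Rightarrow> nat set set" where
  "pot_edges n = [{1..n}]\<^bsup>2\<^esup>"

definition graphs_on :: "nat \<Rightarrow> ngraph set" where
  "graphs_on n = Pow (pot_edges n)"

definition flip :: "nat set \<Rightarrow> ngraph \<Rightarrow> ngraph" where
  "flip e x = (if e \<in> x then x - {e} else insert e x)"

definition edge_diff :: "nat set \<Rightarrow> (ngraph \<Rightarrow> real) \<Rightarrow> ngraph \<Rightarrow> real" where
  "edge_diff e f x = f (insert e x) - f (x - {e})"

definition d_Ham :: "nat \<Rightarrow> ngraph \<Rightarrow> ngraph \<Rightarrow> real" where
  "d_Ham n x y = (\<Sum>e\<in>pot_edges n. \<bar>indicator x e - indicator y e\<bar>)"

definition d_Ham_loc :: "nat \<Rightarrow> nat \<Rightarrow> ngraph \<Rightarrow> ngraph \<Rightarrow> real" where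
  "d_Ham_loc n v x y = (\<Sum>e\<in>{e \<in> pot_edges n. v \<in> e}. \<bar>indicator x e - indicator y e\<bar>)"

definition hom_count :: "fgraph \<Rightarrow> nat \<Rightarrow> ngraph \<Rightarrow> nat" where
  "hom_count G n x = card {f \<in> fst G \<rightarrow>\<^sub>E {1..n}. \<forall>e\<in>snd G. f ` e \<in> x}"

definition hom_density :: "fgraph \<Rightarrow> nat \<Rightarrow> ngraph \<Rightarrow> real" where
  "hom_density G n x = real (hom_count G n x) / real n ^ nverts G"

definition hom_count_edge :: "fgraph \<Rightarrow> nat \<Rightarrow> ngraph \<Rightarrow> nat set \<Rightarrow> real" where
  "hom_count_edge G n x e = edge_diff e (\<lambda>y. real (hom_count G n y)) x"


section \<open>Ferromagnetic ERGM specifications\<close>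

definition ferromagnetic_ergm :: "nat \<Rightarrow> (nat \<Rightarrow> fgraph) \<Rightarrow> (nat \<Rightarrow> real) \<Rightarrow> bool" where
  "ferromagnetic_ergm K G \<beta> \<longleftrightarrow>
     (\<forall>j\<le>K. simple_graph (G j)) \<and> nverts (G 0) = 2 \<and> nedges (G 0) = 1 \<and>
     (\<forall>j\<in>{1..K}. \<beta> j \<ge> 0)"

definition hamiltonian ::
  "nat \<Rightarrow> (nat \<Rightarrow> fgraph) \<Rightarrow> (nat \<Rightarrow> real) \<Rightarrow> nat \<Rightarrow> ngraph \<Rightarrow> real" where
  "hamiltonian K G \<beta> n x = (\<Sum>j\<le>K. \<beta> j * hom_density (G j) n x)"

definition hamiltonian_const ::
  "nat \<Rightarrow> (nat \<Rightarrow> fgraph) \<Rightarrow> (nat \<Rightarrow> real) \<Rightarrow> real \<Rightarrow> real" where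
  "hamiltonian_const K G \<beta> q = (\<Sum>j\<le>K. \<beta> j * q ^ nedges (G j))"

text \<open>The convention \<open>0 log 0 = 0\<close> holds automatically.\<close>
definition entropy_fun :: "real \<Rightarrow> real" where
  "entropy_fun q = 1/2 * q * ln q + 1/2 * (1 - q) * ln (1 - q)"

definition L_fun :: "nat \<Rightarrow> (nat \<Rightarrow> fgraph) \<Rightarrow> (nat \<Rightarrow> real) \<Rightarrow> real \<Rightarrow> real" where
  "L_fun K G \<beta> q = hamiltonian_const K G \<beta> q - entropy_fun q"

definition M_set :: "nat \<Rightarrow> (nat \<Rightarrow> fgraph) \<Rightarrow> (nat \<Rightarrow> real) \<Rightarrow> real set" where
  "M_set K G \<beta> = {q \<in> {0..1}. \<forall>r\<in>{0..1}. L_fun K G \<beta> r \<le> L_fun K G \<beta> q}"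

text \<open>
  The slope of \<^const>\<open>L_fun\<close> is infinite at 0 and 1, so every maximizer is interior and the two-sided
  derivatives are the intended ones.
\<close>
definition U_set :: "nat \<Rightarrow> (nat \<Rightarrow> fgraph) \<Rightarrow> (nat \<Rightarrow> real) \<Rightarrow> real set" where
  "U_set K G \<beta> = {q \<in> M_set K G \<beta>. deriv (deriv (L_fun K G \<beta>)) q < 0}"


section \<open>Graphons and cut distance\<close>

definition graphon :: "(real \<Rightarrow> real \<Rightarrow> real) \<Rightarrow> bool" where
  "graphon W \<longleftrightarrow>
     (\<forall>s\<in>{0..1}. \<forall>t\<in>{0..1}. W s t = W t s \<and> W s t \<in> {0..1}) \<and>
     (\<lambda>(s, t). W s t) \<in> borel_measurable (lebesgue_on ({0..1} \<times> {0..1}))"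

text \<open>
  For \<open>s\<close> in \<open>((i-1)/n, i/n)\<close> one has \<open>\<lceil>n s\<rceil> = i\<close>; the values on grid lines are immaterial.
  Diagonal blocks get the value 0, since no singleton is an edge.
\<close>
definition graph_graphon :: "nat \<Rightarrow> ngraph \<Rightarrow> real \<Rightarrow> real \<Rightarrow> real" where
  "graph_graphon n x s t = indicator x {nat \<lceil>real n * s\<rceil>, nat \<lceil>real n * t\<rceil>}"

definition mp_bijections :: "(real \<Rightarrow> real) set" where
  "mp_bijections = {\<sigma>. bij_betw \<sigma> {0..1} {0..1} \<and>
     \<sigma> \<in> lebesgue_on {0..1} \<rightarrow>\<^sub>M lebesgue_on {0..1} \<and>
     distr (lebesgue_on {0..1}) (lebesgue_on {0..1}) \<sigma> = lebesgue_on {0..1}}"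

definition cut_dist :: "(real \<Rightarrow> real \<Rightarrow> real) \<Rightarrow> (real \<Rightarrow> real \<Rightarrow> real) \<Rightarrow> real" where
  "cut_dist W W' =
     (INF \<sigma>\<in>mp_bijections.
        SUP (S, T)\<in>sets (lebesgue_on {0..1}) \<times> sets (lebesgue_on {0..1}).
          \<bar>LINT s:S|lebesgue. (LINT t:T|lebesgue. W (\<sigma> s) (\<sigma> t) - W' s t)\<bar>)"

definition cut_ball :: "real \<Rightarrow> real \<Rightarrow> (real \<Rightarrow> real \<Rightarrow> real) set" where
  "cut_ball p \<eta> = {W. graphon W \<and> cut_dist W (\<lambda>s t. p) < \<eta>}"

definition graph_ball :: "nat \<Rightarrow> real \<Rightarrow> real \<Rightarrow> ngraph set" where
  "graph_ball n p \<eta> = {x \<in> graphs_on n. graph_graphon n x \<in> cut_ball p \<eta>}"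


section \<open>The conditioned measure and its Glauber dynamics\<close>

definition cond_ergm ::
  "nat \<Rightarrow> (nat \<Rightarrow> fgraph) \<Rightarrow> (nat \<Rightarrow> real) \<Rightarrow> nat \<Rightarrow> real \<Rightarrow> real \<Rightarrow> ngraph pmf" where
  "cond_ergm K G \<beta> n p \<eta> = embed_pmf (\<lambda>x.
     exp (real n ^ 2 * hamiltonian K G \<beta> n x) * indicator (graph_ball n p \<eta>) x /
     (\<Sum>y\<in>graph_ball n p \<eta>. exp (real n ^ 2 * hamiltonian K G \<beta> n y)))"

definition logistic :: "real \<Rightarrow> real" where
  "logistic z = exp z / (1 + exp z)"

definition glauber_step ::
  "nat \<Rightarrow> (nat \<Rightarrow> fgraph) \<Rightarrow> (nat \<Rightarrow> real) \<Rightarrow> nat \<Rightarrow> real \<Rightarrow> real \<Rightarrow> nat set \<times> real \<Rightarrow> ngraph \<Rightarrow> ngraph"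
where
  "glauber_step K G \<beta> n p \<eta> = (\<lambda>(e, u) y.
     let z = (if u \<le> logistic (real n ^ 2 * edge_diff e (hamiltonian K G \<beta> n) y)
              then insert e y else y - {e})
     in if z \<in> graph_ball n p \<eta> then z else y)"

text \<open>
  One i.i.d. sequence of pairs (uniform edge, uniform number in \<open>[0,1]\<close>) drives the chains from all
  starting points; this is the monotone coupling.
\<close>
definition glauber_noise :: "nat \<Rightarrow> (nat set \<times> real) stream measure" where
  "glauber_noise n = stream_space
     (measure_pmf (pmf_of_set (pot_edges n)) \<Otimes>\<^sub>M uniform_measure lborel {0..1})"

primrec glauber ::
  "nat \<Rightarrow> (nat \<Rightarrow> fgraph) \<Rightarrow> (nat \<Rightarrow> real) \<Rightarrow> nat \<Rightarrow> real \<Rightarrow> real \<Rightarrow>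
   ngraph \<Rightarrow> nat \<Rightarrow> (nat set \<times> real) stream \<Rightarrow> ngraph"
where
  "glauber K G \<beta> n p \<eta> x 0 \<omega> = x"
| "glauber K G \<beta> n p \<eta> x (Suc t) \<omega> = glauber_step K G \<beta> n p \<eta> (\<omega> !! t) (glauber K G \<beta> n p \<eta> x t \<omega>)"


section \<open>The good set and the set \<open>\<Lambda>\<^sup>*\<close>\<close>

definition r_stat :: "fgraph \<Rightarrow> nat \<Rightarrow> ngraph \<Rightarrow> nat set \<Rightarrow> real" where
  "r_stat F n x e =
     (hom_count_edge F n x e / (2 * real (nedges F) * real n ^ (nverts F - 2)))
       powr (1 / (real (nedges F) - 1))"

definition Gamma_set :: "nat \<Rightarrow> (nat \<Rightarrow> fgraph) \<Rightarrow> nat \<Rightarrow> real \<Rightarrow> real \<Rightarrow> ngraph set" where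
  "Gamma_set K G n p \<epsilon> = {x \<in> graphs_on n.
     \<forall>e\<in>pot_edges n. \<forall>F. simple_graph F \<and> nverts F \<le> Max ((\<lambda>j. nverts (G j)) ` {..K}) \<and> nedges F > 1
       \<longrightarrow> \<bar>r_stat F n x e - p\<bar> < \<epsilon>}"

definition neighbour_rel :: "nat \<Rightarrow> ngraph set \<Rightarrow> ngraph rel" where
  "neighbour_rel n \<Lambda> = {(x, y). x \<in> \<Lambda> \<and> y \<in> \<Lambda> \<and> d_Ham n x y = 1}"

definition is_Lambda_star ::
  "nat \<Rightarrow> (nat \<Rightarrow> fgraph) \<Rightarrow> (nat \<Rightarrow> real) \<Rightarrow> nat \<Rightarrow> real \<Rightarrow> real \<Rightarrow> real \<Rightarrow> real \<Rightarrow> ngraph set \<Rightarrow> bool"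
where
  "is_Lambda_star K G \<beta> n p \<epsilon> \<eta> \<gamma> \<Lambda> \<longleftrightarrow>
     \<Lambda> \<subseteq> graph_ball n p \<eta> \<and>
     measure_pmf.prob (cond_ergm K G \<beta> n p \<eta>) \<Lambda> \<ge> 1 - exp (- \<gamma> * real n) \<and>
     (\<forall>x\<in>graphs_on n. (\<exists>y\<in>\<Lambda>. d_Ham n x y \<le> 1) \<longrightarrow>
        \<P>(\<omega> in glauber_noise n. \<forall>t::nat. real t < exp (\<gamma> * real n) \<longrightarrow>
             glauber K G \<beta> n p \<eta> x t \<omega> \<in> Gamma_set K G n p \<epsilon> \<inter> graph_ball n p (\<eta> / 2))
          \<ge> 1 - exp (- \<gamma> * real n)) \<and>
     (\<forall>x\<in>\<Lambda>. \<forall>y\<in>\<Lambda>. (x, y) \<in> (neighbour_rel n \<Lambda>)\<^sup>*) \<and>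
     (\<forall>x\<in>\<Lambda>. \<forall>y\<in>\<Lambda>. \<exists>m\<le>2 * n\<^sup>2. (x, y) \<in> neighbour_rel n \<Lambda> ^^ m)"

end

theory Submission
  imports Defs "HOL-Real_Asymp.Real_Asymp"
begin

text \<open>
  The two starting graphs differ in one edge, so one of them contains the other, and the monotone
  coupling keeps the two chains ordered as long as no proposal is rejected. Both chains start within
  Hamming distance 1 of \<open>\<Lambda>\<^sup>*\<close>, so with probability at least \<open>1 - 2 exp (- \<gamma> n)\<close> they
  stay in \<open>\<Gamma>\<close> and in the ball of radius \<open>\<eta>/2\<close> for \<open>exp (\<gamma> n)\<close> steps; there a single flip cannot leave
  the ball of radius \<open>\<eta>\<close>, so every proposal is accepted (\<open>graph_ball_edge_change\<close>), and
  everything reduces to a contraction estimate for ordered pairs \<open>x \<subseteq> y\<close> of good graphs.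

  When the edge \<open>e\<close> is resampled, the two chains disagree at \<open>e\<close> with probability
  \<open>\<phi>(n\<^sup>2 \<partial>\<^sub>e H(y)) - \<phi>(n\<^sup>2 \<partial>\<^sub>e H(x))\<close>. Both arguments lie between \<open>2 H'(p - \<epsilon>)\<close> and \<open>2 H'(p + \<epsilon>)\<close>
  (\<open>edge_field_bounds\<close>), so this is at most \<open>a\<close> times the difference of the arguments, where \<open>a\<close> is close
  to the derivative of \<open>\<phi>\<close> at \<open>2 H'(p)\<close>. That difference is at most the sum over the edges \<open>e'\<close> of \<open>y - x\<close>
  of an influence of \<open>e'\<close> on \<open>e\<close>, which counts the maps of the graphs \<open>G\<^sub>j\<close> into \<open>y\<close> with \<open>e\<close> added whose
  image contains both \<open>e\<close> and \<open>e'\<close>. Summed over \<open>e\<close>, the influence of \<open>e'\<close> is governed by the counts of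
  the graphs \<open>G\<^sub>j\<close> with one edge deleted, which the definition of \<open>\<Gamma>\<close> controls as well; the sum is at most
  \<open>2 H''(p + \<epsilon>) + O(1/n)\<close> (\<open>sum_pair_influence_column_le\<close>). Since \<open>p\<close> is an interior maximizer of \<open>L\<close>, one
  has \<open>\<phi>(2 H'(p)) = p\<close>, hence \<open>\<phi>' = p (1 - p)\<close> there, and \<open>L''(p) < 0\<close> says exactly
  \<open>p (1 - p) 2 H''(p) < 1\<close>. So for small \<open>\<epsilon>\<close> and large \<open>n\<close> the expected Hamming distance contracts by a
  factor \<open>1 - \<delta> / binom(n,2)\<close> per step.

  For the local distance at \<open>v\<close>, an edge \<open>e'\<close> that avoids \<open>v\<close> has total influence only \<open>O(1/n)\<close> on the
  edges at \<open>v\<close>, because a map covering \<open>e'\<close> and an edge at \<open>v\<close> has three prescribed vertices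
  (\<open>sum_pair_influence_at_vertex_le\<close>). Hence the weighted distance in which an edge has weight
  \<open>1[v \<in> e] + A/n\<close> also contracts once \<open>A\<close> is a large constant (\<open>tilted_weight_contraction\<close>). It starts at
  \<open>A/n\<close>, because the flipped edge avoids \<open>v\<close>, and it dominates the local distance, which gives the bound
  for all times up to \<open>exp (\<gamma> n)\<close>. At that time the chains have coalesced except with probability
  exponentially small in \<open>n\<close>, and coalesced chains never separate again, so the bound persists for ever.
\<close>

section \<open>Counting maps that cover prescribed edges\<close>

lemma simple_graph_finite:
  assumes "simple_graph F"
  shows "finite (fst F)" "finite (snd F)"
  using assms finite_subset[OF _ finite_imp_finite_nsets]
  by (auto simp: simple_graph_def)

lemma simple_graph_edgeD:
  assumes "simple_graph F" "g \<in> snd F"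
  shows "g \<subseteq> fst F" "card g = 2" "finite g"
  using assms by (auto simp: simple_graph_def nsets_def)

lemma finite_pot_edges: "finite (pot_edges n)"
  by (simp add: pot_edges_def finite_imp_finite_nsets)

lemma simple_graph_nedges_gt_1:
  assumes "simple_graph F" "nedges F > 1"
  shows "nverts F \<ge> 3"
proof (rule ccontr)
  assume "\<not> nverts F \<ge> 3"
  then have "nverts F \<le> 2" by simp
  have "snd F \<subseteq> {fst F}"
  proof
    fix g assume g: "g \<in> snd F"
    have "card (fst F) \<le> card g"
      using simple_graph_edgeD(2)[OF assms(1) g] \<open>nverts F \<le> 2\<close> by simp
    then have "g = fst F"
      using simple_graph_edgeD(1)[OF assms(1) g] simple_graph_finite(1)[OF assms(1)]
      by (simp add: card_seteq)
    then show "g \<in> {fst F}" by simp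
  qed
  then have "nedges F \<le> 1"
    using card_mono[of "{fst F}" "snd F"] by simp
  with assms(2) show False by simp
qed

definition edge_homs :: "fgraph \<Rightarrow> nat \<Rightarrow> ngraph \<Rightarrow> nat set \<Rightarrow> (nat \<Rightarrow> nat) set" where
  "edge_homs F n y e =
     {f \<in> fst F \<rightarrow>\<^sub>E {1..n}. (\<forall>g\<in>snd F. f ` g \<in> insert e y) \<and> (\<exists>g\<in>snd F. f ` g = e)}"

lemma finite_maps: "simple_graph F \<Longrightarrow> finite (fst F \<rightarrow>\<^sub>E {1..n::nat})"
  by (simp add: finite_PiE simple_graph_finite(1))

lemma finite_edge_homs: "simple_graph F \<Longrightarrow> finite (edge_homs F n y e)"
  using finite_maps by (auto simp: edge_homs_def)

lemma hom_count_edge_eq_card: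
  assumes "simple_graph F"
  shows "hom_count_edge F n y e = real (card (edge_homs F n y e))"
proof -
  let ?H = "\<lambda>y. {f \<in> fst F \<rightarrow>\<^sub>E {1..n}. \<forall>g\<in>snd F. f ` g \<in> y}"
  have fin: "finite (?H z)" for z using finite_maps[OF assms] by auto
  have sub: "?H (y - {e}) \<subseteq> ?H (insert e y)" by auto
  have "edge_homs F n y e = ?H (insert e y) - ?H (y - {e})"
  proof (intro equalityI subsetI)
    fix f assume "f \<in> ?H (insert e y) - ?H (y - {e})"
    then have f: "f \<in> ?H (insert e y)" and "\<not> (\<forall>g\<in>snd F. f ` g \<in> y - {e})" by simp_all
    then obtain g where "g \<in> snd F" "f ` g \<notin> y - {e}" by blast
    moreover from f this have "f ` g \<in> insert e y" by simp
    ultimately have "g \<in> snd F" "f ` g = e" by auto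
    then have "\<exists>g\<in>snd F. f ` g = e" by (rule bexI[rotated])
    with f show "f \<in> edge_homs F n y e" by (simp add: edge_homs_def)
  next
    fix f assume f: "f \<in> edge_homs F n y e"
    then obtain g where "g \<in> snd F" "f ` g = e" by (auto simp: edge_homs_def)
    then have "\<not> (\<forall>g\<in>snd F. f ` g \<in> y - {e})" by (intro notI) (drule (1) bspec, simp)
    with f show "f \<in> ?H (insert e y) - ?H (y - {e})" by (simp add: edge_homs_def)
  qed
  then have "card (edge_homs F n y e) = card (?H (insert e y)) - card (?H (y - {e}))"
    using card_Diff_subset[OF fin sub] by simp
  moreover have "card (?H (y - {e})) \<le> card (?H (insert e y))"
    using card_mono[OF fin sub] .
  ultimately show ?thesis
    by (simp add: hom_count_edge_def edge_diff_def hom_count_def)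
qed

text \<open>
  There are two ways of matching the ends of \<open>h\<close> with those of \<open>e\<close>, and every other vertex is free.
\<close>
lemma card_maps_onto_edge:
  assumes "finite V" "h \<subseteq> V" "card h = 2" "e \<in> pot_edges n"
  shows "card {f \<in> V \<rightarrow>\<^sub>E {1..n}. f ` h = e} * n\<^sup>2 = 2 * n ^ card V"
proof -
  obtain a b where h: "h = {a, b}" "a \<noteq> b" using assms(3) card_2_iff by metis
  have "e \<subseteq> {1..n}" "card e = 2" using assms(4) by (auto simp: pot_edges_def nsets_def)
  then obtain c d where e: "e = {c, d}" "c \<noteq> d" "c \<in> {1..n}" "d \<in> {1..n}"
    using card_2_iff by (metis insert_subset)
  have ab: "a \<in> V" "b \<in> V" using assms(2) h by auto
  let ?A = "\<lambda>c d. PiE V (\<lambda>i. if i = a then {c} else if i = b then {d} else {1..n})"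
  have card_A: "card (?A c d) * n\<^sup>2 = n ^ card V" for c d
  proof -
    have V: "V = insert a (insert b (V - {a, b}))" using ab by auto
    have "card (?A c d) = (\<Prod>i\<in>V. card (if i = a then {c} else if i = b then {d} else {1..n}))"
      using assms(1) by (simp add: card_PiE)
    also have "\<dots> = (\<Prod>i\<in>V - {a, b}. card (if i = a then {c} else if i = b then {d} else {1..n}))"
      using assms(1) h(2) by (subst V) simp
    also have "\<dots> = (\<Prod>i\<in>V - {a, b}. n)" by (rule prod.cong) auto
    also have "\<dots> = n ^ (card V - 2)"
      using assms(1) ab h(2) by (simp add: card_Diff_subset numeral_2_eq_2)
    finally have "card (?A c d) = n ^ (card V - 2)" .
    moreover have "card V \<ge> 2"
      using card_mono[OF assms(1,2)] assms(3) by simp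
    ultimately show ?thesis by (metis le_add_diff_inverse2 power_add)
  qed
  have "{f \<in> V \<rightarrow>\<^sub>E {1..n}. f ` h = e} = ?A c d \<union> ?A d c"
  proof (intro equalityI subsetI)
    fix f assume "f \<in> {f \<in> V \<rightarrow>\<^sub>E {1..n}. f ` h = e}"
    then have f: "f \<in> V \<rightarrow>\<^sub>E {1..n}" "{f a, f b} = {c, d}" using h e by auto
    then have "(f a = c \<and> f b = d) \<or> (f a = d \<and> f b = c)" by (auto simp: doubleton_eq_iff)
    with f(1) show "f \<in> ?A c d \<union> ?A d c" by (auto simp: PiE_iff)
  next
    fix f assume f: "f \<in> ?A c d \<union> ?A d c"
    then have *: "f a = c \<and> f b = d \<or> f a = d \<and> f b = c"
      using ab h(2) by (auto simp: PiE_iff split: if_splits)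
    have "f i \<in> {1..n}" if "i \<in> V" for i
      using f that e(3,4) by (force simp: PiE_iff split: if_splits)
    moreover have "f \<in> extensional V" using f by (auto simp: PiE_iff)
    ultimately show "f \<in> {f \<in> V \<rightarrow>\<^sub>E {1..n}. f ` h = e}"
      using * h(1) e(1) by (auto simp: PiE_iff)
  qed
  moreover have "?A c d \<inter> ?A d c = {}"
    using ab(1) e(2) by (auto simp: PiE_iff) (metis singletonD)
  moreover have "finite (?A c d)" "finite (?A d c)"
    using assms(1) by (auto intro!: finite_PiE)
  ultimately have "card {f \<in> V \<rightarrow>\<^sub>E {1..n}. f ` h = e} = card (?A c d) + card (?A d c)"
    by (simp add: card_Un_disjoint)
  then show ?thesis using card_A by (simp add: algebra_simps)
qed

text \<open>
  Prescribing the image of one further vertex \<open>b\<close>, possibly in terms of the images of the other vertices,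
  costs a factor \<open>n\<close>: such a map is determined by its restriction to the other vertices. Multiplying by
  \<open>n ^ 3\<close> avoids the truncated exponent \<open>card V - 3\<close>.
\<close>
lemma card_maps_onto_edge_constrained:
  fixes \<Phi> :: "(nat \<Rightarrow> nat) \<Rightarrow> nat"
  assumes "finite V" "h \<subseteq> V" "card h = 2" "e \<in> pot_edges n" "b \<in> V" "b \<notin> h"
  shows "card {f \<in> V \<rightarrow>\<^sub>E {1..n}. f ` h = e \<and> f b = \<Phi> (restrict f (V - {b}))} * n ^ 3 \<le> 2 * n ^ card V"
    (is "card ?A * _ \<le> _")
proof -
  let ?B = "{f \<in> (V - {b}) \<rightarrow>\<^sub>E {1..n}. f ` h = e}"
  have le: "card ?A \<le> card ?B"
  proof (rule card_inj_on_le[where f = "\<lambda>f. restrict f (V - {b})"])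
    show "inj_on (\<lambda>f. restrict f (V - {b})) ?A"
    proof (rule inj_onI)
      fix f f' assume f: "f \<in> ?A" "f' \<in> ?A" and eq: "restrict f (V - {b}) = restrict f' (V - {b})"
      have "f i = f' i" if "i \<in> V" for i
      proof (cases "i = b")
        case True then show ?thesis using f eq by auto
      next
        case False
        then show ?thesis using that fun_cong[OF eq, of i] by simp
      qed
      then show "f = f'" using f by (auto intro!: extensionalityI[of f V f'] simp: PiE_iff)
    qed
    show "(\<lambda>f. restrict f (V - {b})) ` ?A \<subseteq> ?B"
    proof (intro image_subsetI CollectI conjI)
      fix f assume f: "f \<in> ?A"
      then show "restrict f (V - {b}) \<in> (V - {b}) \<rightarrow>\<^sub>E {1..n}" by auto
      have "restrict f (V - {b}) ` h = f ` h" using assms(2,6) by (intro image_cong) auto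
      then show "restrict f (V - {b}) ` h = e" using f by simp
    qed
    show "finite ?B"
      by (rule finite_subset[of _ "(V - {b}) \<rightarrow>\<^sub>E {1..n}"]) (auto simp: assms(1) intro!: finite_PiE)
  qed
  have B: "card ?B * n\<^sup>2 = 2 * n ^ card (V - {b})"
    using assms by (intro card_maps_onto_edge) auto
  have V: "n ^ card V = n * n ^ card (V - {b})"
    using card_Suc_Diff1[OF assms(1,5)] by (metis power_Suc)
  have "card ?A * n ^ 3 \<le> card ?B * n ^ 3" using le by simp
  also have "\<dots> = n * (card ?B * n\<^sup>2)" by (simp only: power2_eq_square power3_eq_cube mult.assoc mult.left_commute)
  also have "\<dots> = 2 * n ^ card V" by (simp only: B V mult.left_commute)
  finally show ?thesis .
qed

lemma finite_maps_Collect: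
  "simple_graph F \<Longrightarrow> finite A \<Longrightarrow> finite {f \<in> fst F \<rightarrow>\<^sub>E A. P f}"
  by (rule finite_subset[of _ "fst F \<rightarrow>\<^sub>E A"]) (auto intro!: finite_PiE simple_graph_finite(1))

text \<open>
  Some vertex must be sent to \<open>v\<close>, and it lies outside the edge mapped onto \<open>e\<close> because \<open>v \<notin> e\<close>.
\<close>
lemma card_pinned_maps:
  assumes F: "simple_graph F" and e: "e \<in> pot_edges n" and v: "v \<notin> e"
  shows "card {f \<in> fst F \<rightarrow>\<^sub>E {1..n}. (\<exists>g\<in>snd F. v \<in> f ` g) \<and> (\<exists>h\<in>snd F. f ` h = e)} * n ^ 3
    \<le> 2 * nedges F * nverts F * n ^ nverts F" (is "card ?A * _ \<le> _")
proof -
  \<comment> \<open>\<open>h\<close> is the edge with image \<open>e\<close>, and \<open>w\<close> the vertex with image \<open>v\<close>.\<close>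
  let ?S = "\<lambda>(h, w). {f \<in> fst F \<rightarrow>\<^sub>E {1..n}. f ` h = e \<and> f w = v}"
  let ?I = "SIGMA h:snd F. fst F - h"
  have fin: "finite (snd F)" "finite (fst F)" using simple_graph_finite[OF F] by auto
  have sub: "?A \<subseteq> (\<Union>i\<in>?I. ?S i)"
  proof
    fix f assume "f \<in> ?A"
    then obtain g h where f: "f \<in> fst F \<rightarrow>\<^sub>E {1..n}" and g: "g \<in> snd F" "v \<in> f ` g"
      and h: "h \<in> snd F" "f ` h = e" by blast
    from g(2) obtain w where w: "w \<in> g" "f w = v" by blast
    have "w \<in> fst F" using w(1) simple_graph_edgeD(1)[OF F g(1)] by blast
    moreover have "w \<notin> h" using w(2) h(2) v by blast
    ultimately have "(h, w) \<in> ?I" using h(1) by simp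
    moreover have "f \<in> ?S (h, w)" using f h(2) w(2) by simp
    ultimately show "f \<in> (\<Union>i\<in>?I. ?S i)" by (rule UN_I)
  qed
  have "card ?A * n ^ 3 \<le> card (\<Union>i\<in>?I. ?S i) * n ^ 3"
    using fin by (intro mult_right_mono card_mono[OF _ sub] finite_UN_I) (auto simp: finite_maps_Collect[OF F])
  also have "\<dots> \<le> (\<Sum>i\<in>?I. card (?S i)) * n ^ 3"
    using fin by (intro mult_right_mono card_UN_le) auto
  also have "\<dots> = (\<Sum>i\<in>?I. card (?S i) * n ^ 3)" by (rule sum_distrib_right)
  also have "\<dots> \<le> (\<Sum>i\<in>?I. 2 * n ^ nverts F)"
  proof (rule sum_mono)
    fix i assume "i \<in> ?I"
    then obtain h w where i: "i = (h, w)" "h \<in> snd F" "w \<in> fst F" "w \<notin> h" by blast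
    show "card (?S i) * n ^ 3 \<le> 2 * n ^ nverts F"
      using card_maps_onto_edge_constrained[OF fin(2) simple_graph_edgeD(1,2)[OF F i(2)] e i(3,4),
          where \<Phi> = "\<lambda>_. v"] i(1) by simp
  qed
  also have "\<dots> = card ?I * (2 * n ^ nverts F)" by simp
  also have "\<dots> \<le> (nedges F * nverts F) * (2 * n ^ nverts F)"
  proof (rule mult_right_mono)
    have "card ?I \<le> card (snd F \<times> fst F)" by (rule card_mono) (use fin in auto)
    then show "card ?I \<le> nedges F * nverts F" by (simp add: card_cartesian_product)
  qed simp
  finally show ?thesis by (simp add: ac_simps)
qed

text \<open>
  A coincidence \<open>f a = f b\<close> cannot happen inside the edge \<open>h\<close> mapped onto \<open>e\<close>, so one of \<open>a, b\<close> lies outside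
  \<open>h\<close> and its image is determined by the image of the other.
\<close>
lemma card_noninjective_maps:
  assumes F: "simple_graph F" and e: "e \<in> pot_edges n"
  shows "card {f \<in> fst F \<rightarrow>\<^sub>E {1..n}. \<not> inj_on f (fst F) \<and> (\<exists>h\<in>snd F. f ` h = e)} * n ^ 3
    \<le> 2 * nedges F * nverts F * nverts F * n ^ nverts F" (is "card ?A * _ \<le> _")
proof -
  let ?S = "\<lambda>(h, a, b). {f \<in> fst F \<rightarrow>\<^sub>E {1..n}. f ` h = e \<and> f b = f a}"
  let ?I = "{(h, a, b). h \<in> snd F \<and> a \<in> fst F \<and> b \<in> fst F \<and> a \<noteq> b \<and> b \<notin> h}"
  have fin: "finite (snd F)" "finite (fst F)" using simple_graph_finite[OF F] by auto
  have Isub: "?I \<subseteq> snd F \<times> fst F \<times> fst F" by auto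
  have finI: "finite ?I" by (rule finite_subset[OF Isub]) (use fin in simp)
  have sub: "?A \<subseteq> (\<Union>i\<in>?I. ?S i)"
  proof
    fix f assume "f \<in> ?A"
    then obtain h where f: "f \<in> fst F \<rightarrow>\<^sub>E {1..n}" and inj: "\<not> inj_on f (fst F)"
      and h: "h \<in> snd F" "f ` h = e" by blast
    from inj obtain a b where ab: "a \<in> fst F" "b \<in> fst F" "a \<noteq> b" "f a = f b"
      by (auto simp: inj_on_def)
    have "card (f ` h) = card h"
      using e h(2) simple_graph_edgeD(2)[OF F h(1)] by (simp add: pot_edges_def nsets_def)
    then have "inj_on f h" using simple_graph_edgeD(3)[OF F h(1)] by (simp add: eq_card_imp_inj_on)
    then have "a \<notin> h \<or> b \<notin> h" using ab(3,4) by (auto dest: inj_onD)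
    then show "f \<in> (\<Union>i\<in>?I. ?S i)"
    proof
      assume "b \<notin> h"
      then have "(h, a, b) \<in> ?I" using h(1) ab by simp
      moreover have "f \<in> ?S (h, a, b)" using f h(2) ab(4) by simp
      ultimately show ?thesis by (rule UN_I)
    next
      assume "a \<notin> h"
      then have "(h, b, a) \<in> ?I" using h(1) ab by simp
      moreover have "f \<in> ?S (h, b, a)" using f h(2) ab(4) by simp
      ultimately show ?thesis by (rule UN_I)
    qed
  qed
  have "card ?A * n ^ 3 \<le> card (\<Union>i\<in>?I. ?S i) * n ^ 3"
    using finI by (intro mult_right_mono card_mono[OF _ sub] finite_UN_I) (auto simp: finite_maps_Collect[OF F])
  also have "\<dots> \<le> (\<Sum>i\<in>?I. card (?S i)) * n ^ 3"
    using finI by (intro mult_right_mono card_UN_le) auto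
  also have "\<dots> = (\<Sum>i\<in>?I. card (?S i) * n ^ 3)" by (rule sum_distrib_right)
  also have "\<dots> \<le> (\<Sum>i\<in>?I. 2 * n ^ nverts F)"
  proof (rule sum_mono)
    fix i assume "i \<in> ?I"
    then obtain h a b where i: "i = (h, a, b)" "h \<in> snd F" "a \<in> fst F" "b \<in> fst F" "a \<noteq> b" "b \<notin> h"
      by blast
    show "card (?S i) * n ^ 3 \<le> 2 * n ^ nverts F"
      using card_maps_onto_edge_constrained[OF fin(2) simple_graph_edgeD(1,2)[OF F i(2)] e i(4,6),
          where \<Phi> = "\<lambda>f. f a"] i(1,3,5) by simp
  qed
  also have "\<dots> = card ?I * (2 * n ^ nverts F)" by simp
  also have "\<dots> \<le> (nedges F * nverts F * nverts F) * (2 * n ^ nverts F)"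
  proof (rule mult_right_mono)
    have "card ?I \<le> card (snd F \<times> fst F \<times> fst F)" by (rule card_mono[OF _ Isub]) (use fin in simp)
    then show "card ?I \<le> nedges F * nverts F * nverts F" by (simp add: card_cartesian_product)
  qed simp
  finally show ?thesis by (simp add: ac_simps)
qed

text \<open>
  The discrete mixed derivative of the homomorphism count in the directions \<open>e\<close> and \<open>e'\<close>, for \<open>e' \<in> y\<close>.
\<close>
definition two_edge_homs :: "fgraph \<Rightarrow> nat \<Rightarrow> ngraph \<Rightarrow> nat set \<Rightarrow> nat set \<Rightarrow> (nat \<Rightarrow> nat) set" where
  "two_edge_homs F n y e e' = {f \<in> edge_homs F n y e. \<exists>g\<in>snd F. f ` g = e'}"

lemma finite_two_edge_homs: "simple_graph F \<Longrightarrow> finite (two_edge_homs F n y e e')"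
  using finite_edge_homs by (auto simp: two_edge_homs_def)

lemma edge_homs_mono: "x \<subseteq> y \<Longrightarrow> edge_homs F n x e \<subseteq> edge_homs F n y e"
  by (rule subsetI, simp add: edge_homs_def) (metis subsetD)

lemma hom_count_edge_mono:
  assumes "simple_graph F" "x \<subseteq> y"
  shows "hom_count_edge F n x e \<le> hom_count_edge F n y e"
  using card_mono[OF finite_edge_homs[OF assms(1)] edge_homs_mono[OF assms(2)]]
  by (simp add: hom_count_edge_eq_card[OF assms(1)])

text \<open>
  A map counted at \<open>y\<close> but not at \<open>x\<close> uses an edge of \<open>y - x\<close> besides \<open>e\<close>; the sum is a
  union bound over that edge.
\<close>
lemma hom_count_edge_increment_le:
  assumes F: "simple_graph F" and xy: "x \<subseteq> y" and fin: "finite (y - x)"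
  shows "hom_count_edge F n y e - hom_count_edge F n x e
    \<le> (\<Sum>e'\<in>y - x - {e}. real (card (two_edge_homs F n y e e')))"
proof -
  let ?N = "\<lambda>z. edge_homs F n z e"
  have sub: "?N x \<subseteq> ?N y" using edge_homs_mono[OF xy] .
  have "?N y - ?N x \<subseteq> (\<Union>e'\<in>y - x - {e}. two_edge_homs F n y e e')"
  proof
    fix f assume f: "f \<in> ?N y - ?N x"
    then have "\<not> (\<forall>g\<in>snd F. f ` g \<in> insert e x)" by (simp add: edge_homs_def) metis
    then obtain g where g: "g \<in> snd F" "f ` g \<notin> insert e x" by blast
    moreover from f g(1) have "f ` g \<in> insert e y" by (simp add: edge_homs_def)
    ultimately have *: "f ` g \<in> y - x - {e}" by blast
    have "f \<in> two_edge_homs F n y e (f ` g)" using f g(1) by (auto simp: two_edge_homs_def)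
    then show "f \<in> (\<Union>e'\<in>y - x - {e}. two_edge_homs F n y e e')" by (rule UN_I[OF *])
  qed
  then have "card (?N y - ?N x) \<le> card (\<Union>e'\<in>y - x - {e}. two_edge_homs F n y e e')"
    using fin finite_two_edge_homs[OF F] by (intro card_mono) auto
  also have "\<dots> \<le> (\<Sum>e'\<in>y - x - {e}. card (two_edge_homs F n y e e'))"
    using fin by (intro card_UN_le) auto
  finally have "card (?N y) - card (?N x) \<le> (\<Sum>e'\<in>y - x - {e}. card (two_edge_homs F n y e e'))"
    using card_Diff_subset[OF finite_subset[OF sub finite_edge_homs[OF F]] sub] by simp
  then have "real (card (?N y)) - real (card (?N x)) \<le> real (\<Sum>e'\<in>y - x - {e}. card (two_edge_homs F n y e e'))"
    by linarith
  then show ?thesis by (simp add: hom_count_edge_eq_card[OF F])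
qed

text \<open>
  Each map \<open>f\<close> is counted for at most \<open>nedges F\<close> values of \<open>e\<close>, one for every edge of \<open>F\<close>.
\<close>
lemma sum_two_edge_homs_le:
  assumes F: "simple_graph F" and fin: "finite P"
    and A: "finite A" "\<And>e f. e \<in> P \<Longrightarrow> f \<in> two_edge_homs F n y e e' \<Longrightarrow> f \<in> A"
  shows "(\<Sum>e\<in>P. card (two_edge_homs F n y e e')) \<le> nedges F * card A"
proof -
  let ?S = "SIGMA e:P. two_edge_homs F n y e e'"
  have "?S \<subseteq> (\<lambda>(g, f). (f ` g, f)) ` (snd F \<times> A)"
  proof
    fix z assume "z \<in> ?S"
    then obtain e f where z: "z = (e, f)" "e \<in> P" "f \<in> two_edge_homs F n y e e'" by blast
    then have f: "f \<in> A" using A(2) by blast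
    from z(3) obtain g where g: "g \<in> snd F" "f ` g = e"
      by (auto simp: two_edge_homs_def edge_homs_def)
    then have "z = (\<lambda>(g, f). (f ` g, f)) (g, f)" by (simp add: z(1))
    moreover have "(g, f) \<in> snd F \<times> A" using g f by simp
    ultimately show "z \<in> (\<lambda>(g, f). (f ` g, f)) ` (snd F \<times> A)" by (rule image_eqI)
  qed
  then have "card ?S \<le> card ((\<lambda>(g, f). (f ` g, f)) ` (snd F \<times> A))"
    using simple_graph_finite(2)[OF F] A(1) by (intro card_mono) auto
  also have "\<dots> \<le> card (snd F \<times> A)"
    using simple_graph_finite(2)[OF F] A(1) by (intro card_image_le) auto
  finally show ?thesis using fin finite_two_edge_homs[OF F] by (simp add: card_cartesian_product)
qed

lemma sum_two_edge_homs_at_vertex_le: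
  assumes F: "simple_graph F" and e': "e' \<in> pot_edges n" and v: "v \<notin> e'"
  shows "(\<Sum>e\<in>{e\<in>pot_edges n. v \<in> e}. card (two_edge_homs F n y e e')) * n ^ 3
    \<le> 2 * (nedges F)\<^sup>2 * nverts F * n ^ nverts F"
proof -
  let ?A = "{f \<in> fst F \<rightarrow>\<^sub>E {1..n}. (\<exists>g\<in>snd F. v \<in> f ` g) \<and> (\<exists>h\<in>snd F. f ` h = e')}"
  have "(\<Sum>e\<in>{e\<in>pot_edges n. v \<in> e}. card (two_edge_homs F n y e e')) \<le> nedges F * card ?A"
  proof (rule sum_two_edge_homs_le[OF F])
    show "finite {e \<in> pot_edges n. v \<in> e}" by (simp add: finite_pot_edges)
    show "finite ?A" using finite_maps[OF F, of n] by (rule rev_finite_subset) blast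
    fix e f assume "e \<in> {e \<in> pot_edges n. v \<in> e}" and f: "f \<in> two_edge_homs F n y e e'"
    then have "v \<in> e" by simp
    with f show "f \<in> ?A" by (auto simp: two_edge_homs_def edge_homs_def simp del: image_iff)
  qed
  then have "(\<Sum>e\<in>{e\<in>pot_edges n. v \<in> e}. card (two_edge_homs F n y e e')) * n ^ 3
      \<le> nedges F * card ?A * n ^ 3" by (rule mult_right_mono) simp
  also have "\<dots> = nedges F * (card ?A * n ^ 3)" by (simp only: mult.assoc)
  also have "\<dots> \<le> nedges F * (2 * nedges F * nverts F * n ^ nverts F)"
    by (intro mult_left_mono card_pinned_maps[OF F e' v]) simp
  finally show ?thesis by (simp only: power2_eq_square ac_simps)
qed

definition del_edge :: "fgraph \<Rightarrow> nat set \<Rightarrow> fgraph" where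
  "del_edge F g = (fst F, snd F - {g})"

lemma simple_graph_del_edge: "simple_graph F \<Longrightarrow> simple_graph (del_edge F g)"
  by (auto simp: simple_graph_def del_edge_def)

text \<open>
  Choose an edge \<open>g\<close> of \<open>F\<close> with image \<open>e\<close>. If no other edge of \<open>F\<close> has image \<open>e\<close>, then deleting \<open>g\<close> from \<open>F\<close>
  leaves a map into \<open>y\<close> that uses \<open>e'\<close>; otherwise the map is not injective, and such maps are fewer by a
  factor \<open>n\<close>.
\<close>
lemma sum_two_edge_homs_column_le:
  assumes F: "simple_graph F" and e': "e' \<in> pot_edges n" "e' \<in> y"
  shows "(\<Sum>e\<in>pot_edges n - {e'}. card (two_edge_homs F n y e e')) * n ^ 3
    \<le> (\<Sum>g\<in>snd F. card (edge_homs (del_edge F g) n y e')) * n ^ 3 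
      + 2 * (nedges F)\<^sup>2 * (nverts F)\<^sup>2 * n ^ nverts F"
proof -
  let ?N = "{f \<in> fst F \<rightarrow>\<^sub>E {1..n}. \<not> inj_on f (fst F) \<and> (\<exists>h\<in>snd F. f ` h = e')}"
  let ?A = "\<lambda>g. edge_homs (del_edge F g) n y e' \<union> ?N"
  let ?S = "SIGMA e:pot_edges n - {e'}. two_edge_homs F n y e e'"
  let ?R = "SIGMA g:snd F. ?A g"
  have finN: "finite ?N" using finite_maps[OF F, of n] by (rule rev_finite_subset) blast
  have finA: "finite (?A g)" for g
    using finN finite_edge_homs[OF simple_graph_del_edge[OF F]] by simp
  have finR: "finite ?R" using finA simple_graph_finite(2)[OF F] by auto
  have "?S \<subseteq> (\<lambda>(g, f). (f ` g, f)) ` ?R"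
  proof
    fix z assume "z \<in> ?S"
    then obtain e f where z: "z = (e, f)" "e \<in> pot_edges n" "e \<noteq> e'" "f \<in> two_edge_homs F n y e e'" by blast
    then obtain g h where f: "f \<in> fst F \<rightarrow>\<^sub>E {1..n}" "\<And>h. h \<in> snd F \<Longrightarrow> f ` h \<in> insert e y"
      and g: "g \<in> snd F" "f ` g = e" and h: "h \<in> snd F" "f ` h = e'"
      unfolding two_edge_homs_def edge_homs_def by blast
    have hg: "h \<noteq> g" using g h z(3) by blast
    have "f \<in> ?A g"
    proof (cases "\<exists>k\<in>snd F - {g}. f ` k = e")
      case True
      then obtain k where k: "k \<in> snd F" "k \<noteq> g" "f ` k = f ` g" using g by blast
      have "\<not> inj_on f (fst F)"
        using k inj_on_image_eq_iff[of f "fst F" k g] simple_graph_edgeD(1)[OF F] g(1) by blast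
      then show ?thesis using f(1) h by blast
    next
      case False
      have "\<forall>k\<in>snd F - {g}. f ` k \<in> insert e' y"
        using False f(2) by blast
      moreover have "\<exists>k\<in>snd F - {g}. f ` k = e'" using h hg by blast
      ultimately show ?thesis using f(1) by (simp add: edge_homs_def del_edge_def)
    qed
    then have "(g, f) \<in> ?R" using g by blast
    moreover have "z = (\<lambda>(g, f). (f ` g, f)) (g, f)" using g by (simp add: z(1))
    ultimately show "z \<in> (\<lambda>(g, f). (f ` g, f)) ` ?R" by (rule rev_image_eqI)
  qed
  then have "card ?S \<le> card ((\<lambda>(g, f). (f ` g, f)) ` ?R)" by (intro card_mono finite_imageI finR)
  also have "\<dots> \<le> card ?R" by (rule card_image_le[OF finR])
  also have "\<dots> = (\<Sum>g\<in>snd F. card (?A g))" using finA simple_graph_finite(2)[OF F] by simp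
  also have "\<dots> \<le> (\<Sum>g\<in>snd F. card (edge_homs (del_edge F g) n y e') + card ?N)"
    by (intro sum_mono card_Un_le)
  also have "\<dots> = (\<Sum>g\<in>snd F. card (edge_homs (del_edge F g) n y e')) + nedges F * card ?N"
    by (simp add: sum.distrib)
  finally have "(\<Sum>e\<in>pot_edges n - {e'}. card (two_edge_homs F n y e e'))
      \<le> (\<Sum>g\<in>snd F. card (edge_homs (del_edge F g) n y e')) + nedges F * card ?N" (is "?l \<le> ?s + _")
    using finite_pot_edges finite_two_edge_homs[OF F] by simp
  then have "?l * n ^ 3 \<le> (?s + nedges F * card ?N) * n ^ 3" by (rule mult_right_mono) simp
  also have "\<dots> = ?s * n ^ 3 + nedges F * (card ?N * n ^ 3)" by (simp only: distrib_right mult.assoc)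
  also have "\<dots> \<le> ?s * n ^ 3 + nedges F * (2 * nedges F * nverts F * nverts F * n ^ nverts F)"
    by (intro add_left_mono mult_left_mono card_noninjective_maps[OF F e'(1)]) simp
  finally show ?thesis by (simp only: power2_eq_square ac_simps)
qed

section \<open>Edge fields on the good set\<close>

text \<open>
  This is \<open>2 H'(q)\<close>, the approximate value of \<open>n\<^sup>2 \<partial>\<^sub>e H\<close> in a homogeneous graph of density
  \<open>q\<close>, and \<open>mf_curv\<close> below is its derivative \<open>2 H''(q)\<close>.
\<close>
definition mf_slope :: "nat \<Rightarrow> (nat \<Rightarrow> fgraph) \<Rightarrow> (nat \<Rightarrow> real) \<Rightarrow> real \<Rightarrow> real" where
  "mf_slope K G \<beta> q = (\<Sum>j\<le>K. \<beta> j * (2 * real (nedges (G j)) * q ^ (nedges (G j) - 1)))"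

definition mf_curv :: "nat \<Rightarrow> (nat \<Rightarrow> fgraph) \<Rightarrow> (nat \<Rightarrow> real) \<Rightarrow> real \<Rightarrow> real" where
  "mf_curv K G \<beta> q =
     (\<Sum>j\<le>K. \<beta> j * (real (nedges (G j)) * (2 * real (nedges (G j) - 1) * q ^ (nedges (G j) - 2))))"

definition edge_field ::
  "nat \<Rightarrow> (nat \<Rightarrow> fgraph) \<Rightarrow> (nat \<Rightarrow> real) \<Rightarrow> nat \<Rightarrow> ngraph \<Rightarrow> nat set \<Rightarrow> real" where
  "edge_field K G \<beta> n y e = real n ^ 2 * edge_diff e (hamiltonian K G \<beta> n) y"

text \<open>
  For \<open>e' \<in> y\<close> different from \<open>e\<close>, this is the decrease of \<open>n\<^sup>2 \<partial>\<^sub>e H\<close> when \<open>e'\<close> is removed from \<open>y\<close>.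
\<close>
definition pair_influence ::
  "nat \<Rightarrow> (nat \<Rightarrow> fgraph) \<Rightarrow> (nat \<Rightarrow> real) \<Rightarrow> nat \<Rightarrow> ngraph \<Rightarrow> nat set \<Rightarrow> nat set \<Rightarrow> real" where
  "pair_influence K G \<beta> n y e e' =
     (\<Sum>j\<le>K. \<beta> j * (real n ^ 2 / real n ^ nverts (G j) * real (card (two_edge_homs (G j) n y e e'))))"

text \<open>
  The constant in the \<open>O(1/n)\<close> corrections; it collects the contributions of the noninjective maps and of the
  maps with three prescribed vertices.
\<close>
definition overlap_const :: "nat \<Rightarrow> (nat \<Rightarrow> fgraph) \<Rightarrow> (nat \<Rightarrow> real) \<Rightarrow> real" where
  "overlap_const K G \<beta> = (\<Sum>j\<le>K. \<bar>\<beta> j\<bar> * (2 * (real (nedges (G j)))\<^sup>2 * (real (nverts (G j)))\<^sup>2))"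

lemma ferromagneticD:
  assumes "ferromagnetic_ergm K G \<beta>"
  shows "j \<le> K \<Longrightarrow> simple_graph (G j)" "nedges (G 0) = 1"
    "j \<le> K \<Longrightarrow> j \<noteq> 0 \<Longrightarrow> \<beta> j \<ge> 0"
  using assms by (auto simp: ferromagnetic_ergm_def)

lemma edge_field_eq:
  "edge_field K G \<beta> n y e =
     (\<Sum>j\<le>K. \<beta> j * (real n ^ 2 / real n ^ nverts (G j) * hom_count_edge (G j) n y e))"
  by (simp add: edge_field_def edge_diff_def hamiltonian_def hom_density_def hom_count_edge_def
      sum_distrib_left algebra_simps diff_divide_distrib flip: sum_subtractf)

lemma hom_count_edge_single_edge:
  assumes F: "simple_graph F" "nedges F = 1" and e: "e \<in> pot_edges n" and n: "n > 0"
  shows "real n ^ 2 / real n ^ nverts F * hom_count_edge F n y e = 2"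
proof -
  obtain g where g: "snd F = {g}" using F(2) card_1_singletonE by blast
  have "edge_homs F n y e = {f \<in> fst F \<rightarrow>\<^sub>E {1..n}. f ` g = e}"
    by (rule Collect_cong[THEN trans[OF edge_homs_def]]) (auto simp: g)
  moreover have "card {f \<in> fst F \<rightarrow>\<^sub>E {1..n}. f ` g = e} * n\<^sup>2 = 2 * n ^ nverts F"
    using F g by (intro card_maps_onto_edge e simple_graph_finite simple_graph_edgeD) auto
  ultimately have "real (card (edge_homs F n y e)) * real n ^ 2 = 2 * real n ^ nverts F"
    by (metis of_nat_mult of_nat_numeral of_nat_power)
  then show ?thesis using n by (simp add: hom_count_edge_eq_card[OF F(1)] field_simps)
qed

text \<open>
  For at least two edges this inverts the power in the definition of \<open>r_stat\<close>. A single edge has exactly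
  \<open>2 n ^ (nverts F - 2)\<close> maps onto \<open>e\<close>, whatever the graph \<open>y\<close> is, so that the bounds hold with equality; this
  case is needed when an edge is deleted from a graph with two edges, and for \<open>G 0\<close>.
\<close>
lemma Gamma_hom_count_edge_bounds:
  assumes y: "y \<in> Gamma_set K G n p \<epsilon>" and e: "e \<in> pot_edges n" and n: "n > 0"
    and F: "simple_graph F" "nverts F \<le> Max ((\<lambda>j. nverts (G j)) ` {..K})"
    and p: "0 \<le> p - \<epsilon>"
  shows "2 * real (nedges F) * (p - \<epsilon>) ^ (nedges F - 1)
      \<le> real n ^ 2 / real n ^ nverts F * hom_count_edge F n y e" (is "?L \<le> ?M")
    and "real n ^ 2 / real n ^ nverts F * hom_count_edge F n y e
      \<le> 2 * real (nedges F) * (p + \<epsilon>) ^ (nedges F - 1)" (is "_ \<le> ?U")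
proof -
  have "?L \<le> ?M \<and> ?M \<le> ?U"
  proof -
    consider "nedges F = 0" | "nedges F = 1" | "nedges F > 1" by linarith
    then show ?thesis
    proof cases
      case 1
      then have "edge_homs F n y e = {}"
        using simple_graph_finite(2)[OF F(1)] by (auto simp: edge_homs_def)
      then show ?thesis using 1 by (simp add: hom_count_edge_eq_card[OF F(1)])
    next
      case 2
      then show ?thesis using hom_count_edge_single_edge[OF F(1) 2 e n] by simp
    next
      case 3
      define m where "m = nedges F - 1"
      define r where "r = r_stat F n y e"
      define B where "B = hom_count_edge F n y e / (2 * real (nedges F) * real n ^ (nverts F - 2))"
      have m: "real (nedges F) - 1 = real m" "m > 0" using 3 by (auto simp: m_def)
      have "B \<ge> 0" by (simp add: B_def hom_count_edge_eq_card[OF F(1)])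
      have "r = B powr (1 / real m)" by (simp add: r_def r_stat_def B_def m)
      then have rB: "r ^ m = B" and r0: "r \<ge> 0"
        using m \<open>B \<ge> 0\<close> by (auto simp: powr_powr simp flip: powr_realpow' split: if_splits)
      have "\<bar>r - p\<bar> < \<epsilon>" using y e F 3 unfolding Gamma_set_def r_def by blast
      then have "(p - \<epsilon>) ^ m \<le> B" "B \<le> (p + \<epsilon>) ^ m"
        unfolding rB[symmetric] using p r0 by (auto intro!: power_mono)
      moreover have "?M = 2 * real (nedges F) * B"
      proof -
        have "nverts F - 2 + 2 = nverts F" using simple_graph_nedges_gt_1[OF F(1) 3] by simp
        then have "real n ^ nverts F = real n ^ (nverts F - 2) * real n ^ 2" by (metis power_add)
        then show ?thesis using n 3 by (simp add: B_def)
      qed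
      ultimately show ?thesis
        unfolding m_def by (auto intro!: mult_left_mono)
    qed
  qed
  then show "?L \<le> ?M" "?M \<le> ?U" by auto
qed

lemma nverts_le_Max: "(j::nat) \<le> K \<Longrightarrow> nverts (G j) \<le> Max ((\<lambda>j. nverts (G j)) ` {..K})"
  by (intro Max_ge) auto

text \<open>
  The coefficient \<open>\<beta> 0\<close> may be negative, but the term of the single edge \<open>G 0\<close> does not depend on \<open>y\<close>; all
  other coefficients are nonnegative, so the bounds on the counts can be summed.
\<close>
lemma edge_field_bounds:
  assumes ferro: "ferromagnetic_ergm K G \<beta>" and y: "y \<in> Gamma_set K G n p \<epsilon>"
    and e: "e \<in> pot_edges n" and n: "n > 0" and p: "0 \<le> p - \<epsilon>"
  shows "mf_slope K G \<beta> (p - \<epsilon>) \<le> edge_field K G \<beta> n y e"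
    and "edge_field K G \<beta> n y e \<le> mf_slope K G \<beta> (p + \<epsilon>)"
proof -
  note D = ferromagneticD[OF ferro]
  have eq: "real n ^ 2 / real n ^ nverts (G 0) * hom_count_edge (G 0) n y e = 2"
    by (rule hom_count_edge_single_edge[OF D(1) D(2) e n]) simp
  show "mf_slope K G \<beta> (p - \<epsilon>) \<le> edge_field K G \<beta> n y e"
    unfolding mf_slope_def edge_field_eq
  proof (rule sum_mono)
    fix j assume "j \<in> {..K}"
    then have j: "j \<le> K" by simp
    show "\<beta> j * (2 * real (nedges (G j)) * (p - \<epsilon>) ^ (nedges (G j) - 1))
        \<le> \<beta> j * (real n ^ 2 / real n ^ nverts (G j) * hom_count_edge (G j) n y e)"
    proof (cases "j = 0")
      case True
      then show ?thesis using eq D(2) by simp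
    next
      case False
      then show ?thesis
        by (intro mult_left_mono D(3) j Gamma_hom_count_edge_bounds(1)[OF y e n D(1)[OF j] nverts_le_Max[OF j] p])
    qed
  qed
  show "edge_field K G \<beta> n y e \<le> mf_slope K G \<beta> (p + \<epsilon>)"
    unfolding mf_slope_def edge_field_eq
  proof (rule sum_mono)
    fix j assume "j \<in> {..K}"
    then have j: "j \<le> K" by simp
    show "\<beta> j * (real n ^ 2 / real n ^ nverts (G j) * hom_count_edge (G j) n y e)
        \<le> \<beta> j * (2 * real (nedges (G j)) * (p + \<epsilon>) ^ (nedges (G j) - 1))"
    proof (cases "j = 0")
      case True
      then show ?thesis using eq D(2) by simp
    next
      case False
      then show ?thesis
        by (intro mult_left_mono D(3) j Gamma_hom_count_edge_bounds(2)[OF y e n D(1)[OF j] nverts_le_Max[OF j] p])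
    qed
  qed
qed

lemma two_edge_homs_single_edge:
  assumes "nedges F = 1" "e \<noteq> e'"
  shows "two_edge_homs F n y e e' = {}"
proof -
  obtain g where "snd F = {g}" using assms(1) card_1_singletonE by blast
  then show ?thesis using assms(2) by (auto simp: two_edge_homs_def edge_homs_def)
qed

lemma edge_field_mono:
  assumes ferro: "ferromagnetic_ergm K G \<beta>" and xy: "x \<subseteq> y"
    and e: "e \<in> pot_edges n" and n: "n > 0"
  shows "edge_field K G \<beta> n x e \<le> edge_field K G \<beta> n y e"
  unfolding edge_field_eq
proof (rule sum_mono)
  note D = ferromagneticD[OF ferro]
  fix j assume "j \<in> {..K}"
  then have j: "j \<le> K" by simp
  show "\<beta> j * (real n ^ 2 / real n ^ nverts (G j) * hom_count_edge (G j) n x e)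
      \<le> \<beta> j * (real n ^ 2 / real n ^ nverts (G j) * hom_count_edge (G j) n y e)"
  proof (cases "j = 0")
    case True
    have "real n ^ 2 / real n ^ nverts (G 0) * hom_count_edge (G 0) n z e = 2" for z
      by (rule hom_count_edge_single_edge[OF D(1) D(2) e n]) simp
    with True show ?thesis by simp
  next
    case False
    then show ?thesis
      by (intro mult_left_mono D(3) j hom_count_edge_mono D(1) xy) auto
  qed
qed

lemma edge_field_increment_le:
  assumes ferro: "ferromagnetic_ergm K G \<beta>" and xy: "x \<subseteq> y" "finite (y - x)"
    and e: "e \<in> pot_edges n" and n: "n > 0"
  shows "edge_field K G \<beta> n y e - edge_field K G \<beta> n x e
    \<le> (\<Sum>e'\<in>y - x - {e}. pair_influence K G \<beta> n y e e')"
proof -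
  note D = ferromagneticD[OF ferro]
  let ?s = "\<lambda>j. real n ^ 2 / real n ^ nverts (G j)"
  have "edge_field K G \<beta> n y e - edge_field K G \<beta> n x e
    = (\<Sum>j\<le>K. \<beta> j * (?s j * (hom_count_edge (G j) n y e - hom_count_edge (G j) n x e)))"
    by (simp add: edge_field_eq right_diff_distrib flip: sum_subtractf)
  also have "\<dots> \<le> (\<Sum>j\<le>K. \<beta> j * (?s j * (\<Sum>e'\<in>y - x - {e}. real (card (two_edge_homs (G j) n y e e')))))"
  proof (rule sum_mono)
    fix j assume "j \<in> {..K}"
    then have j: "j \<le> K" by simp
    show "\<beta> j * (?s j * (hom_count_edge (G j) n y e - hom_count_edge (G j) n x e))
      \<le> \<beta> j * (?s j * (\<Sum>e'\<in>y - x - {e}. real (card (two_edge_homs (G j) n y e e'))))"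
    proof (cases "j = 0")
      case True
      have "?s 0 * hom_count_edge (G 0) n z e = 2" for z
        by (rule hom_count_edge_single_edge[OF D(1) D(2) e n]) simp
      then have "?s 0 * (hom_count_edge (G 0) n y e - hom_count_edge (G 0) n x e) = 0"
        by (simp only: right_diff_distrib)
      moreover have "(\<Sum>e'\<in>y - x - {e}. real (card (two_edge_homs (G 0) n y e e'))) = 0"
      proof (intro sum.neutral ballI)
        fix e' assume "e' \<in> y - x - {e}"
        then have "e \<noteq> e'" by blast
        then show "real (card (two_edge_homs (G 0) n y e e')) = 0"
          by (simp add: two_edge_homs_single_edge[OF D(2)])
      qed
      ultimately show ?thesis using True n by simp
    next
      case False
      then show ?thesis
        by (intro mult_left_mono D(3) j hom_count_edge_increment_le D(1) xy) simp_all
    qed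
  qed
  also have "\<dots> = (\<Sum>e'\<in>y - x - {e}. pair_influence K G \<beta> n y e e')"
    unfolding pair_influence_def sum_distrib_left by (rule sum.swap)
  finally show ?thesis .
qed

text \<open>
  The passage from counts to densities: at the scale \<open>n\<^sup>2 / n ^ v\<close>, a count of order \<open>n ^ v / n ^ 3\<close> becomes a
  term of order \<open>1 / n\<close>.
\<close>
lemma cube_scaling:
  assumes "n > 0" and "a * real n ^ 3 \<le> b * real n ^ 3 + c * real n ^ v"
  shows "real n ^ 2 / real n ^ v * a \<le> real n ^ 2 / real n ^ v * b + c / real n"
proof -
  have "real n ^ 2 / real n ^ v * a = (a * real n ^ 3) / (real n ^ v * real n)"
    using assms(1) by (simp add: field_simps power2_eq_square power3_eq_cube)
  also have "\<dots> \<le> (b * real n ^ 3 + c * real n ^ v) / (real n ^ v * real n)"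
    using assms by (intro divide_right_mono) auto
  also have "\<dots> = real n ^ 2 / real n ^ v * b + c / real n"
    using assms(1) by (simp add: field_simps power2_eq_square power3_eq_cube)
  finally show ?thesis .
qed

text \<open>
  Among the graphs controlled by \<open>\<Gamma>\<close> are those obtained from \<open>G j\<close> by deleting an edge; summing their counts
  over the deleted edge produces the second derivative of \<open>H\<close>.
\<close>
lemma sum_pair_influence_column_le:
  assumes ferro: "ferromagnetic_ergm K G \<beta>" and y: "y \<in> Gamma_set K G n p \<epsilon>"
    and e': "e' \<in> pot_edges n" "e' \<in> y" and n: "n > 0" and p: "0 \<le> p - \<epsilon>"
  shows "(\<Sum>e\<in>pot_edges n - {e'}. pair_influence K G \<beta> n y e e')
    \<le> mf_curv K G \<beta> (p + \<epsilon>) + overlap_const K G \<beta> / real n"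
proof -
  note D = ferromagneticD[OF ferro]
  let ?s = "\<lambda>j. real n ^ 2 / real n ^ nverts (G j)"
  let ?q = "\<lambda>j. (\<Sum>e\<in>pot_edges n - {e'}. real (card (two_edge_homs (G j) n y e e')))"
  have "(\<Sum>e\<in>pot_edges n - {e'}. pair_influence K G \<beta> n y e e') = (\<Sum>j\<le>K. \<beta> j * (?s j * ?q j))"
    unfolding pair_influence_def sum_distrib_left by (rule sum.swap)
  also have "\<dots> \<le> (\<Sum>j\<le>K. \<beta> j * (real (nedges (G j)) * (2 * real (nedges (G j) - 1) * (p + \<epsilon>) ^ (nedges (G j) - 2)))
       + (\<bar>\<beta> j\<bar> * (2 * (real (nedges (G j)))\<^sup>2 * (real (nverts (G j)))\<^sup>2)) / real n)"
  proof (rule sum_mono)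
    fix j assume "j \<in> {..K}"
    then have j: "j \<le> K" by simp
    note Gj = D(1)[OF j]
    show "\<beta> j * (?s j * ?q j) \<le> \<beta> j * (real (nedges (G j)) * (2 * real (nedges (G j) - 1) * (p + \<epsilon>) ^ (nedges (G j) - 2)))
       + (\<bar>\<beta> j\<bar> * (2 * (real (nedges (G j)))\<^sup>2 * (real (nverts (G j)))\<^sup>2)) / real n"
    proof (cases "j = 0")
      case True
      then have "?q j = 0"
        using two_edge_homs_single_edge[OF D(2)] by (intro sum.neutral) auto
      then show ?thesis using True D(2) by simp
    next
      case False
      then have b: "\<beta> j \<ge> 0" using D(3) j by simp
      let ?d = "\<lambda>g. real (card (edge_homs (del_edge (G j) g) n y e'))"
      have "real ((\<Sum>e\<in>pot_edges n - {e'}. card (two_edge_homs (G j) n y e e')) * n ^ 3)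
          \<le> real ((\<Sum>g\<in>snd (G j). card (edge_homs (del_edge (G j) g) n y e')) * n ^ 3
            + 2 * (nedges (G j))\<^sup>2 * (nverts (G j))\<^sup>2 * n ^ nverts (G j))"
        using sum_two_edge_homs_column_le[OF Gj e'] by (rule of_nat_mono)
      then have "?q j * real n ^ 3 \<le> (\<Sum>g\<in>snd (G j). ?d g) * real n ^ 3
          + (2 * (real (nedges (G j)))\<^sup>2 * (real (nverts (G j)))\<^sup>2) * real n ^ nverts (G j)"
        by simp
      from cube_scaling[OF n this]
      have "?s j * ?q j \<le> (\<Sum>g\<in>snd (G j). ?s j * ?d g)
          + (2 * (real (nedges (G j)))\<^sup>2 * (real (nverts (G j)))\<^sup>2) / real n"
        by (simp add: sum_distrib_left)
      also have "(\<Sum>g\<in>snd (G j). ?s j * ?d g)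
          \<le> (\<Sum>g\<in>snd (G j). 2 * real (nedges (G j) - 1) * (p + \<epsilon>) ^ (nedges (G j) - 2))"
      proof (rule sum_mono)
        fix g assume g: "g \<in> snd (G j)"
        have "nedges (del_edge (G j) g) = nedges (G j) - 1" "nverts (del_edge (G j) g) = nverts (G j)"
          using g simple_graph_finite(2)[OF Gj] by (auto simp: del_edge_def)
        then show "?s j * ?d g \<le> 2 * real (nedges (G j) - 1) * (p + \<epsilon>) ^ (nedges (G j) - 2)"
          using Gamma_hom_count_edge_bounds(2)[OF y e'(1) n simple_graph_del_edge[OF Gj], of g]
            nverts_le_Max[OF j, of G] p
          by (simp add: hom_count_edge_eq_card[OF simple_graph_del_edge[OF Gj]] numeral_2_eq_2)
      qed
      also have "\<dots> = real (nedges (G j)) * (2 * real (nedges (G j) - 1) * (p + \<epsilon>) ^ (nedges (G j) - 2))"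
        by simp
      finally have "?s j * ?q j \<le> real (nedges (G j)) * (2 * real (nedges (G j) - 1) * (p + \<epsilon>) ^ (nedges (G j) - 2))
          + (2 * (real (nedges (G j)))\<^sup>2 * (real (nverts (G j)))\<^sup>2) / real n"
        by simp
      then have "\<beta> j * (?s j * ?q j)
        \<le> \<beta> j * (real (nedges (G j)) * (2 * real (nedges (G j) - 1) * (p + \<epsilon>) ^ (nedges (G j) - 2))
          + (2 * (real (nedges (G j)))\<^sup>2 * (real (nverts (G j)))\<^sup>2) / real n)"
        by (rule mult_left_mono) (rule b)
      then show ?thesis using b by (simp add: distrib_left)
    qed
  qed
  also have "\<dots> = mf_curv K G \<beta> (p + \<epsilon>) + overlap_const K G \<beta> / real n"
    by (simp add: mf_curv_def overlap_const_def sum.distrib sum_divide_distrib)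
  finally show ?thesis .
qed

lemma sum_pair_influence_at_vertex_le:
  assumes ferro: "ferromagnetic_ergm K G \<beta>" and e': "e' \<in> pot_edges n" and v: "v \<notin> e'"
    and n: "n > 0"
  shows "(\<Sum>e\<in>{e\<in>pot_edges n. v \<in> e}. pair_influence K G \<beta> n y e e')
    \<le> overlap_const K G \<beta> / real n"
proof -
  note D = ferromagneticD[OF ferro]
  let ?s = "\<lambda>j. real n ^ 2 / real n ^ nverts (G j)"
  let ?q = "\<lambda>j. (\<Sum>e\<in>{e\<in>pot_edges n. v \<in> e}. real (card (two_edge_homs (G j) n y e e')))"
  have "(\<Sum>e\<in>{e\<in>pot_edges n. v \<in> e}. pair_influence K G \<beta> n y e e') = (\<Sum>j\<le>K. \<beta> j * (?s j * ?q j))"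
    unfolding pair_influence_def sum_distrib_left by (rule sum.swap)
  also have "\<dots> \<le> (\<Sum>j\<le>K. (\<bar>\<beta> j\<bar> * (2 * (real (nedges (G j)))\<^sup>2 * (real (nverts (G j)))\<^sup>2)) / real n)"
  proof (rule sum_mono)
    fix j assume "j \<in> {..K}"
    then have j: "j \<le> K" by simp
    have "?s j * ?q j \<le> (2 * (real (nedges (G j)))\<^sup>2 * (real (nverts (G j)))\<^sup>2) / real n"
    proof -
      let ?l = "\<Sum>e\<in>{e\<in>pot_edges n. v \<in> e}. card (two_edge_homs (G j) n y e e')"
      have "?l * n ^ 3 \<le> 2 * (nedges (G j))\<^sup>2 * nverts (G j) * n ^ nverts (G j)"
        by (rule sum_two_edge_homs_at_vertex_le[OF D(1)[OF j] e' v])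
      also have "\<dots> \<le> 2 * (nedges (G j))\<^sup>2 * (nverts (G j))\<^sup>2 * n ^ nverts (G j)"
        by (intro mult_right_mono mult_left_mono) (auto simp: power2_eq_square)
      finally have "real (?l * n ^ 3) \<le> real (2 * (nedges (G j))\<^sup>2 * (nverts (G j))\<^sup>2 * n ^ nverts (G j))"
        by (rule of_nat_mono)
      then have "?q j * real n ^ 3 \<le> 0 * real n ^ 3
          + (2 * (real (nedges (G j)))\<^sup>2 * (real (nverts (G j)))\<^sup>2) * real n ^ nverts (G j)"
        by simp
      from cube_scaling[OF n this] show ?thesis by simp
    qed
    moreover have "0 \<le> ?s j * ?q j" by (intro mult_nonneg_nonneg sum_nonneg) auto
    ultimately have "\<bar>\<beta> j\<bar> * (?s j * ?q j)
        \<le> \<bar>\<beta> j\<bar> * ((2 * (real (nedges (G j)))\<^sup>2 * (real (nverts (G j)))\<^sup>2) / real n)"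
      by (intro mult_left_mono) auto
    moreover have "\<beta> j * (?s j * ?q j) \<le> \<bar>\<beta> j\<bar> * (?s j * ?q j)"
      using \<open>0 \<le> ?s j * ?q j\<close> by (intro mult_right_mono) auto
    ultimately show "\<beta> j * (?s j * ?q j)
      \<le> (\<bar>\<beta> j\<bar> * (2 * (real (nedges (G j)))\<^sup>2 * (real (nverts (G j)))\<^sup>2)) / real n" by simp
  qed
  also have "\<dots> = overlap_const K G \<beta> / real n"
    by (simp add: overlap_const_def sum_divide_distrib)
  finally show ?thesis .
qed

lemma pair_influence_nonneg:
  assumes ferro: "ferromagnetic_ergm K G \<beta>" and "e \<noteq> e'"
  shows "pair_influence K G \<beta> n y e e' \<ge> 0"
  unfolding pair_influence_def
proof (rule sum_nonneg)
  note D = ferromagneticD[OF ferro]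
  fix j assume j: "j \<in> {..K}"
  show "0 \<le> \<beta> j * (real n ^ 2 / real n ^ nverts (G j) * real (card (two_edge_homs (G j) n y e e')))"
  proof (cases "j = 0")
    case True
    then show ?thesis using two_edge_homs_single_edge[OF D(2) assms(2)] by simp
  next
    case False
    then show ?thesis using j D(3) by simp
  qed
qed

section \<open>The mean-field fixed point\<close>

lemma hamiltonian_const_has_derivative:
  "(hamiltonian_const K G \<beta> has_real_derivative mf_slope K G \<beta> q / 2) (at q)"
proof -
  have "((\<lambda>q. \<Sum>j\<le>K. \<beta> j * q ^ nedges (G j)) has_real_derivative
      (\<Sum>j\<le>K. \<beta> j * (real (nedges (G j)) * q ^ (nedges (G j) - 1)))) (at q)"
    by (auto intro!: derivative_eq_intros sum.cong)
  moreover have "(\<Sum>j\<le>K. \<beta> j * (real (nedges (G j)) * q ^ (nedges (G j) - 1))) = mf_slope K G \<beta> q / 2"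
    by (simp add: mf_slope_def sum_divide_distrib algebra_simps)
  ultimately show ?thesis unfolding hamiltonian_const_def[abs_def] by (simp only:)
qed

lemma mf_slope_has_derivative:
  "(mf_slope K G \<beta> has_real_derivative mf_curv K G \<beta> q) (at q)"
  unfolding mf_slope_def[abs_def] mf_curv_def
  by (auto intro!: derivative_eq_intros sum.cong simp: diff_diff_left numeral_2_eq_2)

lemma entropy_fun_has_derivative:
  assumes "0 < q" "q < 1"
  shows "(entropy_fun has_real_derivative (ln q - ln (1 - q)) / 2) (at q)"
proof -
  have "((\<lambda>q. q * ln q) has_real_derivative ln q + 1) (at q)"
    using assms by (auto intro!: derivative_eq_intros)
  moreover have "((\<lambda>q. (1 - q) * ln (1 - q)) has_real_derivative - ln (1 - q) - 1) (at q)"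
    using assms by (auto intro!: derivative_eq_intros)
  ultimately have "((\<lambda>q. (1/2) * (q * ln q) + (1/2) * ((1 - q) * ln (1 - q))) has_real_derivative
      (1/2) * (ln q + 1) + (1/2) * (- ln (1 - q) - 1)) (at q)"
    by (intro DERIV_add DERIV_cmult)
  moreover have "(1/2) * (ln q + 1) + (1/2) * (- ln (1 - q) - 1) = (ln q - ln (1 - q)) / 2"
    by (simp add: field_simps)
  ultimately show ?thesis unfolding entropy_fun_def[abs_def] by (simp only: mult.assoc)
qed

lemma L_fun_has_derivative:
  assumes "0 < q" "q < 1"
  shows "(L_fun K G \<beta> has_real_derivative (mf_slope K G \<beta> q - (ln q - ln (1 - q))) / 2) (at q)"
  unfolding L_fun_def[abs_def]
  using DERIV_diff[OF hamiltonian_const_has_derivative entropy_fun_has_derivative[OF assms]]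
  by (simp add: diff_divide_distrib)

lemma deriv_deriv_L_fun:
  assumes "0 < q" "q < 1"
  shows "deriv (deriv (L_fun K G \<beta>)) q = (mf_curv K G \<beta> q - 1 / (q * (1 - q))) / 2"
proof -
  let ?f = "\<lambda>q. (mf_slope K G \<beta> q - (ln q - ln (1 - q))) / 2"
  have der: "(?f has_real_derivative (mf_curv K G \<beta> q - 1 / (q * (1 - q))) / 2) (at q)"
    using assms by (auto intro!: derivative_eq_intros mf_slope_has_derivative simp: field_simps)
  have ev: "\<forall>\<^sub>F r in nhds q. ?f r = deriv (L_fun K G \<beta>) r"
    using eventually_nhds_in_open[of "{0<..<1}" q] assms
    by (auto elim!: eventually_mono simp: DERIV_imp_deriv[OF L_fun_has_derivative])
  have "(deriv (L_fun K G \<beta>) has_real_derivative (mf_curv K G \<beta> q - 1 / (q * (1 - q))) / 2) (at q)"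
    by (rule iffD1[OF DERIV_cong_ev[OF refl ev refl] der])
  then show ?thesis by (rule DERIV_imp_deriv)
qed

lemma ex_small_neg_ln: "\<exists>s\<in>{0<..<1::real}. C < - (1/2) * ln s"
proof
  let ?s = "exp (- 2 * \<bar>C\<bar> - 1)"
  show "C < - (1/2) * ln ?s" unfolding ln_exp using abs_ge_self[of C] by argo
  show "?s \<in> {0<..<1}" by simp
qed

text \<open>
  The entropy has infinite slope at 0 and 1, while \<open>H\<close> is Lipschitz, so moving a maximizer from the boundary
  into the interval by a small \<open>s\<close> would gain \<open>- (s/2) ln s\<close> and lose only a multiple of \<open>s\<close>.
\<close>
lemma maximizer_interior:
  assumes ferro: "ferromagnetic_ergm K G \<beta>" and p: "p \<in> M_set K G \<beta>"
  shows "0 < p" "p < 1"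
proof -
  note D = ferromagneticD[OF ferro]
  have p01: "0 \<le> p" "p \<le> 1" and max: "\<And>r. 0 \<le> r \<Longrightarrow> r \<le> 1 \<Longrightarrow> L_fun K G \<beta> r \<le> L_fun K G \<beta> p"
    using p by (auto simp: M_set_def)
  have split: "(\<Sum>j\<le>K. f j) = f 0 + (\<Sum>j=1..K. f j)" for f :: "nat \<Rightarrow> real"
  proof -
    have "{..K} = insert 0 {1..K}" by auto
    then show ?thesis by simp
  qed
  \<comment> \<open>Near 0 only \<open>\<beta> 0\<close> can make \<open>H\<close> decrease, since the other terms are nondecreasing.\<close>
  show "0 < p"
  proof (rule ccontr)
    assume "\<not> 0 < p"
    then have p0: "p = 0" using p01 by simp
    obtain s where s: "0 < s" "s < 1" "\<bar>\<beta> 0\<bar> < - (1/2) * ln s"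
      using ex_small_neg_ln[of "\<bar>\<beta> 0\<bar>"] by auto
    have "hamiltonian_const K G \<beta> s - hamiltonian_const K G \<beta> 0
        = (\<Sum>j\<le>K. \<beta> j * (s ^ nedges (G j) - 0 ^ nedges (G j)))"
      by (simp add: hamiltonian_const_def right_diff_distrib sum_subtractf)
    also have "\<dots> = \<beta> 0 * s + (\<Sum>j=1..K. \<beta> j * (s ^ nedges (G j) - 0 ^ nedges (G j)))"
      by (subst split) (simp add: D(2))
    also have "\<dots> \<ge> \<beta> 0 * s + 0"
      using s by (intro add_left_mono sum_nonneg mult_nonneg_nonneg D(3)) (auto simp: power_0_left)
    finally have 1: "\<beta> 0 * s \<le> hamiltonian_const K G \<beta> s - hamiltonian_const K G \<beta> 0" by simp
    have 2: "entropy_fun s \<le> 1/2 * s * ln s"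
      using s by (simp add: entropy_fun_def mult_nonneg_nonpos)
    have 3: "entropy_fun 0 = 0" by (simp add: entropy_fun_def)
    have "- (\<bar>\<beta> 0\<bar> * s) \<le> \<beta> 0 * s" using s by (simp add: abs_if)
    moreover have "\<bar>\<beta> 0\<bar> * s < - (1/2) * ln s * s" using s by (intro mult_strict_right_mono) auto
    ultimately have "L_fun K G \<beta> 0 < L_fun K G \<beta> s"
      using 1 2 3 by (simp add: L_fun_def algebra_simps)
    then show False using max[of s] s p0 by simp
  qed
  show "p < 1"
  proof (rule ccontr)
    assume "\<not> p < 1"
    then have p1: "p = 1" using p01 by simp
    define C where "C = (\<Sum>j\<le>K. \<bar>\<beta> j\<bar> * real (nedges (G j)))"
    obtain s where s: "0 < s" "s < 1" "C < - (1/2) * ln s"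
      using ex_small_neg_ln[of C] by auto
    have "hamiltonian_const K G \<beta> 1 - hamiltonian_const K G \<beta> (1 - s)
        = (\<Sum>j\<le>K. \<beta> j * (1 - (1 - s) ^ nedges (G j)))"
      by (simp add: hamiltonian_const_def right_diff_distrib sum_subtractf)
    also have "\<dots> \<le> (\<Sum>j\<le>K. \<bar>\<beta> j\<bar> * real (nedges (G j)) * s)"
    proof (rule sum_mono)
      fix j
      have "1 + real (nedges (G j)) * (- s) \<le> (1 + (- s)) ^ nedges (G j)"
        using s by (intro Bernoulli_inequality) auto
      then have "1 - (1 - s) ^ nedges (G j) \<le> real (nedges (G j)) * s" by simp
      moreover have "0 \<le> 1 - (1 - s) ^ nedges (G j)" using s by (simp add: power_le_one)
      ultimately show "\<beta> j * (1 - (1 - s) ^ nedges (G j)) \<le> \<bar>\<beta> j\<bar> * real (nedges (G j)) * s"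
        unfolding mult.assoc by (intro mult_mono) auto
    qed
    also have "\<dots> = C * s" by (simp add: C_def sum_distrib_right)
    finally have 1: "hamiltonian_const K G \<beta> 1 - hamiltonian_const K G \<beta> (1 - s) \<le> C * s" .
    have 2: "entropy_fun (1 - s) \<le> 1/2 * s * ln s"
      using s by (simp add: entropy_fun_def mult_nonneg_nonpos)
    have 3: "entropy_fun 1 = 0" by (simp add: entropy_fun_def)
    have "C * s < - (1/2) * ln s * s" using s by (intro mult_strict_right_mono) auto
    then have "L_fun K G \<beta> 1 < L_fun K G \<beta> (1 - s)"
      using 1 2 3 by (simp add: L_fun_def algebra_simps)
    then show False using max[of "1 - s"] s p1 by simp
  qed
qed

lemma logistic_has_derivative:
  "(logistic has_real_derivative logistic z * (1 - logistic z)) (at z)"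
proof -
  have "1 + exp z \<noteq> 0" using exp_gt_zero[of z] by linarith
  then show ?thesis unfolding logistic_def[abs_def]
    by (auto intro!: derivative_eq_intros simp: field_simps)
qed

lemma logistic_bounds: "0 < logistic z" "logistic z < 1"
proof -
  have "0 < 1 + exp z" using exp_gt_zero[of z] by linarith
  then show "0 < logistic z" "logistic z < 1" by (auto simp: logistic_def field_simps)
qed

text \<open>
  The first-order condition \<open>L'(p) = 0\<close> says that \<open>p\<close> is a fixed point of the mean-field map
  \<open>q \<mapsto> \<phi>(2 H'(q))\<close>, and \<open>L''(p) < 0\<close> says that the derivative of this map at \<open>p\<close> is less than 1.
\<close>
lemma U_set_contraction:
  assumes ferro: "ferromagnetic_ergm K G \<beta>" and p: "p \<in> U_set K G \<beta>"
  shows "logistic (mf_slope K G \<beta> p) = p"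
    and "p * (1 - p) * mf_curv K G \<beta> p < 1"
proof -
  have M: "p \<in> M_set K G \<beta>" using p by (simp add: U_set_def)
  note p01 = maximizer_interior[OF ferro M]
  have "(mf_slope K G \<beta> p - (ln p - ln (1 - p))) / 2 = 0"
  proof (rule DERIV_local_max[OF L_fun_has_derivative[OF p01]])
    show "0 < min p (1 - p)" using p01 by simp
    show "\<forall>y. \<bar>p - y\<bar> < min p (1 - p) \<longrightarrow> L_fun K G \<beta> y \<le> L_fun K G \<beta> p"
      using M by (auto simp: M_set_def abs_if split: if_splits)
  qed
  then have "mf_slope K G \<beta> p = ln (p / (1 - p))" using p01 by (simp add: ln_div)
  then have e: "exp (mf_slope K G \<beta> p) = p / (1 - p)" using p01 by simp
  have "1 + p / (1 - p) = 1 / (1 - p)" using p01 by (simp add: field_simps)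
  then show "logistic (mf_slope K G \<beta> p) = p" using p01 by (simp add: logistic_def e)
  have "(mf_curv K G \<beta> p - 1 / (p * (1 - p))) / 2 < 0"
    using p p01 by (simp add: U_set_def deriv_deriv_L_fun)
  then show "p * (1 - p) * mf_curv K G \<beta> p < 1" using p01 by (simp add: field_simps)
qed

lemma mf_curv_nonneg:
  assumes ferro: "ferromagnetic_ergm K G \<beta>" and "0 \<le> q"
  shows "0 \<le> mf_curv K G \<beta> q"
  unfolding mf_curv_def
proof (rule sum_nonneg)
  note D = ferromagneticD[OF ferro]
  fix j assume j: "j \<in> {..K}"
  show "0 \<le> \<beta> j * (real (nedges (G j)) * (2 * real (nedges (G j) - 1) * q ^ (nedges (G j) - 2)))"
    using D(2) D(3)[of j] j assms(2) by (cases "j = 0") auto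
qed

lemma continuous_mf: "isCont (mf_slope K G \<beta>) q" "isCont (mf_curv K G \<beta>) q" "isCont logistic q"
  using DERIV_isCont[OF mf_slope_has_derivative] DERIV_isCont[OF logistic_has_derivative]
  by (auto simp: mf_curv_def[abs_def])

text \<open>
  By continuity the strict inequality at \<open>p\<close> survives when the two factors are evaluated at different nearby
  points: the slope of \<open>\<phi>\<close> anywhere between the extreme fields, and the second derivative of \<open>H\<close> at
  \<open>p + \<epsilon>\<close>.
\<close>
lemma uniform_contraction:
  assumes ferro: "ferromagnetic_ergm K G \<beta>" and p: "p \<in> U_set K G \<beta>"
  obtains \<epsilon>\<^sub>0 where "0 < \<epsilon>\<^sub>0" "\<epsilon>\<^sub>0 \<le> p"
    "\<And>\<epsilon>. 0 < \<epsilon> \<Longrightarrow> \<epsilon> < \<epsilon>\<^sub>0 \<Longrightarrow> \<exists>a>0. a * mf_curv K G \<beta> (p + \<epsilon>) < 1 \<and>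
      (\<forall>z. mf_slope K G \<beta> (p - \<epsilon>) \<le> z \<and> z \<le> mf_slope K G \<beta> (p + \<epsilon>) \<longrightarrow> logistic z * (1 - logistic z) \<le> a)"
proof -
  let ?h = "mf_slope K G \<beta>" and ?c = "mf_curv K G \<beta>"
  have p01: "0 < p" "p < 1"
    using maximizer_interior[OF ferro] p by (auto simp: U_set_def)
  have log: "logistic (?h p) = p" and contr: "p * (1 - p) * ?c p < 1"
    using U_set_contraction[OF ferro p] .
  have c0: "?c p \<ge> 0" using mf_curv_nonneg[OF ferro] p01 by simp
  obtain a where a: "p * (1 - p) < a" "a * ?c p < 1"
  proof -
    show thesis
    proof (cases "?c p = 0")
      case True
      then show thesis using that[of "p * (1 - p) + 1"] by simp
    next
      case False
      then have "p * (1 - p) < 1 / ?c p" using contr c0 by (simp add: pos_less_divide_eq)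
      then obtain a where "p * (1 - p) < a" "a < 1 / ?c p" using dense by blast
      then show thesis using that[of a] c0 False by (simp add: pos_less_divide_eq)
    qed
  qed
  have a0: "a > 0" using a(1) p01 by (smt (verit) mult_pos_pos)
  have "isCont (\<lambda>z. logistic z * (1 - logistic z)) (?h p)"
    by (intro continuous_intros continuous_mf)
  then have "(\<lambda>z. logistic z * (1 - logistic z)) \<midarrow>?h p\<rightarrow> p * (1 - p)"
    by (simp add: isCont_def log)
  then have "\<forall>\<^sub>F z in at (?h p). logistic z * (1 - logistic z) < a"
    using a(1) by (rule order_tendstoD)
  then obtain d1 where d1: "d1 > 0" "\<And>z. z \<noteq> ?h p \<Longrightarrow> \<bar>z - ?h p\<bar> < d1 \<Longrightarrow> logistic z * (1 - logistic z) < a"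
    by (auto simp: eventually_at dist_real_def)
  have d1': "logistic z * (1 - logistic z) < a" if "\<bar>z - ?h p\<bar> < d1" for z
    using d1(2)[of z] that a(1) log by (cases "z = ?h p") auto
  obtain d2 where d2: "d2 > 0" "\<And>q. \<bar>q - p\<bar> < d2 \<Longrightarrow> \<bar>?h q - ?h p\<bar> < d1"
    using continuous_mf(1)[where q = p, unfolded continuous_at_eps_delta, rule_format, OF d1(1)]
    unfolding dist_real_def by blast
  have "isCont (\<lambda>q. a * ?c q) p" by (intro continuous_intros continuous_mf)
  then have "\<forall>\<^sub>F q in at p. a * ?c q < 1"
    using a(2) by (auto simp: isCont_def intro: order_tendstoD)
  then obtain d3 where d3: "d3 > 0" "\<And>q. q \<noteq> p \<Longrightarrow> \<bar>q - p\<bar> < d3 \<Longrightarrow> a * ?c q < 1"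
    by (auto simp: eventually_at dist_real_def)
  show ?thesis
  proof (rule that[of "min p (min d2 d3)"])
    show "0 < min p (min d2 d3)" using p01 d2 d3 by simp
    show "min p (min d2 d3) \<le> p" by simp
    fix \<epsilon> assume e: "0 < \<epsilon>" "\<epsilon> < min p (min d2 d3)"
    have 1: "\<bar>?h (p - \<epsilon>) - ?h p\<bar> < d1" "\<bar>?h (p + \<epsilon>) - ?h p\<bar> < d1"
      using e by (auto intro!: d2(2))
    have "a * ?c (p + \<epsilon>) < 1" using e by (intro d3(2)) auto
    moreover have "logistic z * (1 - logistic z) \<le> a" if "?h (p - \<epsilon>) \<le> z" "z \<le> ?h (p + \<epsilon>)" for z
    proof -
      have "\<bar>z - ?h p\<bar> < d1" using 1 that by (simp add: abs_less_iff)
      from d1'[OF this] show ?thesis by simp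
    qed
    ultimately show "\<exists>a>0. a * ?c (p + \<epsilon>) < 1 \<and>
      (\<forall>z. ?h (p - \<epsilon>) \<le> z \<and> z \<le> ?h (p + \<epsilon>) \<longrightarrow> logistic z * (1 - logistic z) \<le> a)"
      using a0 by blast
  qed
qed

lemma logistic_diff_le:
  assumes "z \<le> w" and "\<And>u. z \<le> u \<Longrightarrow> u \<le> w \<Longrightarrow> logistic u * (1 - logistic u) \<le> a"
  shows "logistic w - logistic z \<le> a * (w - z)"
proof (cases "z = w")
  case False
  then have "z < w" using assms(1) by simp
  then obtain u where u: "z < u" "u < w" "logistic w - logistic z = (w - z) * (logistic u * (1 - logistic u))"
    using MVT2[of z w logistic "\<lambda>u. logistic u * (1 - logistic u)"] logistic_has_derivative by auto
  then show ?thesis using assms(2)[of u] \<open>z < w\<close> by (simp add: mult.commute[of a] mult_left_mono)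
qed simp

lemma logistic_mono: "z \<le> w \<Longrightarrow> logistic z \<le> logistic w"
  using DERIV_nonneg_imp_nondecreasing[of z w logistic] logistic_has_derivative logistic_bounds
  by (metis diff_ge_0_iff_ge less_eq_real_def mult_nonneg_nonneg)

section \<open>Changing one edge in the cut distance\<close>

abbreviation unit_leb :: "real measure" where "unit_leb \<equiv> lebesgue_on {0..1}"

definition block_of :: "nat \<Rightarrow> real \<Rightarrow> nat" where
  "block_of n s = nat \<lceil>real n * s\<rceil>"

lemma graph_graphon_block: "graph_graphon n x s t = indicator x {block_of n s, block_of n t}"
  by (simp add: graph_graphon_def block_of_def)

lemma measurable_block_of [measurable]: "block_of n \<in> borel \<rightarrow>\<^sub>M count_space UNIV"
  unfolding block_of_def[abs_def] by measurable

lemma measurable_borel_lebesgue_on: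
  assumes "f \<in> borel \<rightarrow>\<^sub>M M" shows "f \<in> lebesgue_on S \<rightarrow>\<^sub>M M"
proof -
  have "f \<in> lborel \<rightarrow>\<^sub>M M" using assms by (simp cong: measurable_cong_sets)
  then show ?thesis by (intro measurable_restrict_space1 measurable_completion)
qed

lemma graphon_graph_graphon: "graphon (graph_graphon n x)"
  unfolding graphon_def
proof (intro conjI ballI)
  fix s t :: real
  show "graph_graphon n x s t = graph_graphon n x t s"
    by (simp add: graph_graphon_block insert_commute)
  show "graph_graphon n x s t \<in> {0..1}"
    by (simp add: graph_graphon_def indicator_def)
next
  have f: "(\<lambda>z::real \<times> real. block_of n (fst z)) \<in> borel \<rightarrow>\<^sub>M count_space UNIV"
    and g: "(\<lambda>z::real \<times> real. block_of n (snd z)) \<in> borel \<rightarrow>\<^sub>M count_space UNIV"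
    unfolding borel_prod[symmetric] by measurable
  have "(\<lambda>z. indicator x {block_of n (fst z), block_of n (snd z)} :: real) \<in> borel_measurable (borel :: (real \<times> real) measure)"
    by (rule measurable_compose_countable[OF measurable_compose_countable[OF _ g] f]) simp
  then have "(\<lambda>z. indicator x {block_of n (fst z), block_of n (snd z)} :: real)
      \<in> borel_measurable (lebesgue_on ({0..1} \<times> {0..1}))"
    by (rule measurable_borel_lebesgue_on)
  then show "(\<lambda>(s, t). graph_graphon n x s t) \<in> borel_measurable (lebesgue_on ({0..1} \<times> {0..1}))"
    by (simp add: graph_graphon_block case_prod_beta')
qed

text \<open>
  The quantity whose absolute value is maximized over \<open>S\<close> and \<open>T\<close> in the cut distance between a relabelled
  graph and the constant graphon.
\<close>
definition cut_val :: "nat \<Rightarrow> ngraph \<Rightarrow> real \<Rightarrow> (real \<Rightarrow> real) \<Rightarrow> real set \<Rightarrow> real set \<Rightarrow> real" where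
  "cut_val n x p \<sigma> S T = (LINT s:S|lebesgue. (LINT t:T|lebesgue. graph_graphon n x (\<sigma> s) (\<sigma> t) - p))"

lemma cut_dist_eq:
  "cut_dist (graph_graphon n x) (\<lambda>s t. p) = (INF \<sigma>\<in>mp_bijections.
     SUP (S, T)\<in>sets unit_leb \<times> sets unit_leb. \<bar>cut_val n x p \<sigma> S T\<bar>)"
  unfolding cut_dist_def cut_val_def ..

lemma sets_unit_leb: "S \<in> sets unit_leb \<longleftrightarrow> S \<subseteq> {0..1} \<and> S \<in> sets lebesgue"
  by (simp add: sets_restrict_space_iff)

lemma measure_subset_unit:
  assumes "S \<in> sets unit_leb"
  shows "measure lebesgue S \<le> 1" "emeasure lebesgue S < \<infinity>"
proof -
  have S: "S \<in> sets lebesgue" "S \<subseteq> {0..1}" using assms sets_unit_leb by auto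
  have "emeasure lebesgue S \<le> emeasure lebesgue {0..1::real}"
    by (rule emeasure_mono[OF S(2)]) auto
  then have *: "emeasure lebesgue S \<le> 1" by simp
  then show "emeasure lebesgue S < \<infinity>" using le_less_trans[OF *, of top] by (simp add: ennreal_one_less_top)
  then have "ennreal (measure lebesgue S) \<le> 1"
    using * by (simp add: emeasure_eq_ennreal_measure)
  then show "measure lebesgue S \<le> 1" by (metis ennreal_1 ennreal_le_iff zero_le_one)
qed

lemma set_integrable_unit_bounded:
  fixes f :: "real \<Rightarrow> real"
  assumes S: "S \<in> sets unit_leb" and f: "f \<in> borel_measurable unit_leb" and B: "\<And>s. s \<in> S \<Longrightarrow> \<bar>f s\<bar> \<le> B"
  shows "set_integrable lebesgue S f"
proof -
  have S': "S \<in> sets lebesgue" "S \<subseteq> {0..1}" using S sets_unit_leb by auto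
  have "f \<in> borel_measurable (lebesgue_on S)"
    using f S'(2) by (rule measurable_restrict_mono)
  then have m: "(\<lambda>s. indicator S s *\<^sub>R f s) \<in> borel_measurable lebesgue"
    using borel_measurable_restrict_space_iff[of S lebesgue f] S'(1) by simp
  show ?thesis unfolding set_integrable_def
  proof (rule Bochner_Integration.integrable_bound[where f = "\<lambda>s. B * indicator S s"])
    show "integrable lebesgue (\<lambda>s. B * indicator S s)"
      using S'(1) measure_subset_unit(2)[OF S] by (intro integrable_mult_right integrable_real_indicator)
    show "AE s in lebesgue. norm (indicator S s *\<^sub>R f s) \<le> norm (B * indicator S s)"
      using B by (intro AE_I2) (force simp: indicator_def)
  qed (rule m)
qed

lemma abs_set_integral_unit_le:
  fixes f :: "real \<Rightarrow> real"
  assumes S: "S \<in> sets unit_leb" and f: "f \<in> borel_measurable unit_leb" and B: "\<And>s. s \<in> S \<Longrightarrow> \<bar>f s\<bar> \<le> B" "0 \<le> B"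
  shows "\<bar>LINT s:S|lebesgue. f s\<bar> \<le> B"
proof -
  have S': "S \<in> sets lebesgue" "S \<subseteq> {0..1}" using S sets_unit_leb by auto
  have int: "integrable lebesgue (\<lambda>s. B * indicator S s)"
    using S'(1) measure_subset_unit(2)[OF S] by (intro integrable_mult_right integrable_real_indicator)
  have "\<bar>LINT s:S|lebesgue. f s\<bar> \<le> (LINT s|lebesgue. \<bar>indicator S s *\<^sub>R f s\<bar>)"
    unfolding set_lebesgue_integral_def by (rule integral_abs_bound)
  also have "\<dots> \<le> (LINT s|lebesgue. B * indicator S s)"
    using set_integrable_unit_bounded[OF S f B(1)] B int unfolding set_integrable_def
    by (intro integral_mono) (auto simp: indicator_def)
  also have "\<dots> = B * measure lebesgue S" using S' by simp
  also have "\<dots> \<le> B" using measure_subset_unit(1)[OF S] B(2) by (simp add: mult_left_le)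
  finally show ?thesis .
qed

text \<open>
  Measure-preserving relabelling does not change the measure \<open>1/n\<close> of the points belonging to one vertex.
\<close>
lemma measure_blocks:
  assumes n: "n > 0" and sub: "A \<subseteq> {1..n}"
    and \<sigma>: "\<sigma> \<in> mp_bijections"
  shows "measure lebesgue {s \<in> {0..1}. block_of n (\<sigma> s) \<in> A} \<le> card A / n"
    and "{s \<in> {0..1}. block_of n (\<sigma> s) \<in> A} \<in> sets unit_leb"
proof -
  let ?B = "{s \<in> {0..1}. block_of n s \<in> A}"
  have \<sigma>m: "\<sigma> \<in> unit_leb \<rightarrow>\<^sub>M unit_leb" and dist: "distr unit_leb unit_leb \<sigma> = unit_leb"
    using \<sigma> by (auto simp: mp_bijections_def)
  have "{s \<in> space unit_leb. block_of n s \<in> A} \<in> sets unit_leb"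
    by (rule measurable_sets_Collect[OF measurable_borel_lebesgue_on[OF measurable_block_of]]) simp
  then have B: "?B \<in> sets unit_leb" by simp
  have sp: "space unit_leb = {0..1}" by simp
  have \<sigma>01: "\<sigma> s \<in> {0..1}" if "s \<in> {0..1}" for s
    using measurable_space[OF \<sigma>m, of s] that unfolding sp .
  have eq: "{s \<in> {0..1}. block_of n (\<sigma> s) \<in> A} = \<sigma> -` ?B \<inter> space unit_leb"
    unfolding sp using \<sigma>01 by blast
  show m: "{s \<in> {0..1}. block_of n (\<sigma> s) \<in> A} \<in> sets unit_leb"
    unfolding eq by (rule measurable_sets[OF \<sigma>m B])
  have "measure lebesgue {s \<in> {0..1}. block_of n (\<sigma> s) \<in> A} = measure unit_leb (\<sigma> -` ?B \<inter> space unit_leb)"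
    unfolding eq[symmetric] by (rule measure_restrict_space[symmetric]) auto
  also have "\<dots> = measure (distr unit_leb unit_leb \<sigma>) ?B"
    by (rule measure_distr[symmetric, OF \<sigma>m B])
  also have "\<dots> = measure lebesgue ?B"
    unfolding dist by (rule measure_restrict_space) auto
  also have "\<dots> \<le> measure lebesgue (\<Union>k\<in>A. {(real k - 1) / n..real k / n})"
  proof (rule measure_mono_fmeasurable)
    show "?B \<subseteq> (\<Union>k\<in>A. {(real k - 1) / n..real k / n})"
    proof
      fix s assume s: "s \<in> ?B"
      let ?k = "block_of n s"
      have k: "?k \<in> A" "?k \<ge> 1" using s sub by auto
      have "real_of_int \<lceil>real n * s\<rceil> = real ?k" using k(2) by (simp add: block_of_def)
      then have "real n * s \<le> real ?k" "real ?k - 1 < real n * s"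
        by (metis le_of_int_ceiling) (metis ceiling_correct \<open>real_of_int \<lceil>real n * s\<rceil> = real ?k\<close>)
      then have "s \<in> {(real ?k - 1) / n..real ?k / n}" using n by (simp add: field_simps)
      then show "s \<in> (\<Union>k\<in>A. {(real k - 1) / n..real k / n})" using k(1) by blast
    qed
    show "?B \<in> sets lebesgue" using B sets_unit_leb by blast
    show "(\<Union>k\<in>A. {(real k - 1) / n..real k / n}) \<in> lmeasurable"
      using finite_subset[OF sub] by (intro fmeasurable.finite_UN) auto
  qed
  also have "\<dots> \<le> (\<Sum>k\<in>A. measure lebesgue {(real k - 1) / n..real k / n})"
    using finite_subset[OF sub] by (intro measure_UNION_le) auto
  also have "\<dots> = (\<Sum>k\<in>A. 1 / n)"
    using n by (intro sum.cong) (auto simp: field_simps)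
  finally show "measure lebesgue {s \<in> {0..1}. block_of n (\<sigma> s) \<in> A} \<le> card A / n" by simp
qed

text \<open>
  The inner integral depends on \<open>s\<close> only through the vertex of \<open>\<sigma> s\<close> and is unaffected by the status of \<open>e\<close>
  unless this vertex is an end of \<open>e\<close>, which happens on a set of measure at most \<open>2/n\<close>; there the two inner
  integrals differ by at most 2.
\<close>
lemma cut_val_estimates:
  assumes \<sigma>: "\<sigma> \<in> mp_bijections" and ST: "S \<in> sets unit_leb" "T \<in> sets unit_leb"
    and p: "0 \<le> p" "p \<le> 1"
  shows "\<bar>cut_val n x p \<sigma> S T\<bar> \<le> 1"
    and "n > 0 \<Longrightarrow> e \<in> pot_edges n \<Longrightarrow> x - {e} = y - {e} \<Longrightarrow>
      \<bar>cut_val n x p \<sigma> S T\<bar> \<le> \<bar>cut_val n y p \<sigma> S T\<bar> + 4 / n"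
proof -
  have \<sigma>m: "\<sigma> \<in> unit_leb \<rightarrow>\<^sub>M unit_leb" using \<sigma> by (auto simp: mp_bijections_def)
  have bm: "(\<lambda>s. block_of n (\<sigma> s)) \<in> unit_leb \<rightarrow>\<^sub>M count_space UNIV"
    using measurable_compose[OF \<sigma>m measurable_borel_lebesgue_on[OF measurable_block_of]] .
  have fm: "(\<lambda>s. f (block_of n (\<sigma> s))) \<in> borel_measurable unit_leb" for f :: "nat \<Rightarrow> real"
    by (rule measurable_compose[OF bm]) simp
  define I where "I z i = (LINT t:T|lebesgue. indicator z {i, block_of n (\<sigma> t)} - p)" for z i
  have cv: "cut_val n z p \<sigma> S T = (LINT s:S|lebesgue. I z (block_of n (\<sigma> s)))" for z
    by (simp add: cut_val_def I_def graph_graphon_block)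
  have inner: "\<bar>indicator z {i, j} - p\<bar> \<le> 1" for z and i j :: nat
    using p by (auto simp: indicator_def)
  have I1: "\<bar>I z i\<bar> \<le> 1" for z i
    unfolding I_def by (rule abs_set_integral_unit_le[OF ST(2) fm]) (use inner in auto)
  show "\<bar>cut_val n x p \<sigma> S T\<bar> \<le> 1"
    unfolding cv by (rule abs_set_integral_unit_le[OF ST(1) fm]) (use I1 in auto)
  assume n: "n > 0" and e: "e \<in> pot_edges n" and xy: "x - {e} = y - {e}"
  have e': "e \<subseteq> {1..n}" "card e = 2" using e by (auto simp: pot_edges_def nsets_def)
  let ?E = "{s \<in> {0..1}. block_of n (\<sigma> s) \<in> e}"
  have same: "I x i = I y i" if "i \<notin> e" for i
  proof -
    have "indicator x {i, j} = (indicator y {i, j} :: real)" for j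
    proof -
      have "{i, j} \<noteq> e" using that by blast
      then have "{i, j} \<in> x \<longleftrightarrow> {i, j} \<in> y" using xy by blast
      then show ?thesis by (simp add: indicator_def)
    qed
    then show ?thesis by (simp add: I_def)
  qed
  note E = measure_blocks[OF n e'(1) \<sigma>]
  have E': "?E \<in> sets lebesgue" using E(2) sets_unit_leb by blast
  have int: "set_integrable lebesgue S (\<lambda>s. I z (block_of n (\<sigma> s)))" for z
    by (rule set_integrable_unit_bounded[OF ST(1) fm, of _ 1]) (use I1 in auto)
  have "cut_val n x p \<sigma> S T - cut_val n y p \<sigma> S T
      = (LINT s:S|lebesgue. I x (block_of n (\<sigma> s)) - I y (block_of n (\<sigma> s)))"
    unfolding cv by (rule set_integral_diff(2)[symmetric, OF int int])
  also have "\<bar>\<dots>\<bar> \<le> (LINT s|lebesgue. \<bar>indicator S s *\<^sub>R (I x (block_of n (\<sigma> s)) - I y (block_of n (\<sigma> s)))\<bar>)"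
    unfolding set_lebesgue_integral_def by (rule integral_abs_bound)
  also have "\<dots> \<le> (LINT s|lebesgue. 2 * indicator ?E s)"
  proof (rule integral_mono)
    show "integrable lebesgue (\<lambda>s. \<bar>indicator S s *\<^sub>R (I x (block_of n (\<sigma> s)) - I y (block_of n (\<sigma> s)))\<bar>)"
      using set_integral_diff(1)[OF int[of x] int[of y]] unfolding set_integrable_def by (rule integrable_abs)
    show "integrable lebesgue (\<lambda>s. 2 * indicator ?E s :: real)"
      using E' measure_subset_unit(2)[OF E(2)] by (intro integrable_mult_right integrable_real_indicator)
    fix s
    have S01: "S \<subseteq> {0..1}" using ST(1) sets_unit_leb by blast
    have "\<bar>I x i - I y i\<bar> \<le> 2" for i using I1[of x i] I1[of y i] by linarith
    then show "\<bar>indicator S s *\<^sub>R (I x (block_of n (\<sigma> s)) - I y (block_of n (\<sigma> s)))\<bar> \<le> 2 * indicator ?E s"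
      using S01 same[of "block_of n (\<sigma> s)"] by (auto simp: indicator_def)
  qed
  also have "\<dots> = 2 * measure lebesgue ?E" using E' by simp
  also have "\<dots> \<le> 4 / n" using E(1) e'(2) by simp
  finally show "\<bar>cut_val n x p \<sigma> S T\<bar> \<le> \<bar>cut_val n y p \<sigma> S T\<bar> + 4 / n" by linarith
qed

lemma cut_dist_edge_change:
  assumes p: "0 \<le> p" "p \<le> 1" and n: "n > 0" and e: "e \<in> pot_edges n" and xy: "x - {e} = y - {e}"
  shows "cut_dist (graph_graphon n x) (\<lambda>s t. p) \<le> cut_dist (graph_graphon n y) (\<lambda>s t. p) + 4 / n"
proof -
  let ?P = "sets unit_leb \<times> sets unit_leb"
  let ?D = "\<lambda>z \<sigma>. SUP (S, T)\<in>?P. \<bar>cut_val n z p \<sigma> S T\<bar>"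
  have ne: "?P \<noteq> {}" by auto
  have bdd: "bdd_above ((\<lambda>(S, T). \<bar>cut_val n z p \<sigma> S T\<bar>) ` ?P)" if "\<sigma> \<in> mp_bijections" for z \<sigma>
    using cut_val_estimates(1)[OF that _ _ p] by (intro bdd_aboveI2[of _ _ 1]) auto
  have nonneg: "0 \<le> ?D z \<sigma>" if "\<sigma> \<in> mp_bijections" for z \<sigma>
    using cSUP_upper2[OF bdd[OF that, of z], of "({}, {})" 0] by auto
  have le: "?D x \<sigma> \<le> ?D y \<sigma> + 4 / n" if \<sigma>: "\<sigma> \<in> mp_bijections" for \<sigma>
  proof (rule cSUP_least[OF ne])
    fix z assume "z \<in> ?P"
    then obtain S T where z: "z = (S, T)" and ST: "S \<in> sets unit_leb" "T \<in> sets unit_leb" by blast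
    have "\<bar>cut_val n x p \<sigma> S T\<bar> \<le> \<bar>cut_val n y p \<sigma> S T\<bar> + 4 / n"
      by (rule cut_val_estimates(2)[OF \<sigma> ST p n e xy])
    also have "\<bar>cut_val n y p \<sigma> S T\<bar> \<le> ?D y \<sigma>"
      using cSUP_upper[OF _ bdd[OF \<sigma>, of y], of "(S, T)"] ST by simp
    finally show "(case z of (S, T) \<Rightarrow> \<bar>cut_val n x p \<sigma> S T\<bar>) \<le> ?D y \<sigma> + 4 / n"
      by (simp add: z)
  qed
  have "id \<in> mp_bijections" by (simp add: mp_bijections_def distr_id[unfolded id_def] id_def bij_betw_id_iff[unfolded id_def])
  then have ne': "mp_bijections \<noteq> {}" by auto
  have "(INF \<sigma>\<in>mp_bijections. ?D x \<sigma>) - 4 / n \<le> (INF \<sigma>\<in>mp_bijections. ?D y \<sigma>)"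
  proof (rule cINF_greatest[OF ne'])
    fix \<sigma> assume \<sigma>: "\<sigma> \<in> mp_bijections"
    have "(INF \<sigma>\<in>mp_bijections. ?D x \<sigma>) \<le> ?D x \<sigma>"
      using nonneg by (intro cINF_lower \<sigma> bdd_belowI2[of _ 0]) auto
    then show "(INF \<sigma>\<in>mp_bijections. ?D x \<sigma>) - 4 / n \<le> ?D y \<sigma>" using le[OF \<sigma>] by linarith
  qed
  then show ?thesis by (simp add: cut_dist_eq)
qed

text \<open>
  This is why no proposal is rejected while the chains remain in the smaller ball.
\<close>
lemma graph_ball_edge_change:
  assumes p: "0 \<le> p" "p \<le> 1" and n: "n > 0" "8 / \<eta> < n" "\<eta> > 0" and e: "e \<in> pot_edges n"
    and y: "y \<in> graph_ball n p (\<eta> / 2)"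
  shows "insert e y \<in> graph_ball n p \<eta>" "y - {e} \<in> graph_ball n p \<eta>"
proof -
  have "4 / n < \<eta> / 2" using n by (simp add: field_simps)
  then have *: "z \<in> graph_ball n p \<eta>" if "z - {e} = y - {e}" "z \<in> graphs_on n" for z
    using cut_dist_edge_change[OF p n(1) e that(1)] y that(2)
    by (auto simp: graph_ball_def cut_ball_def graphon_graph_graphon)
  show "insert e y \<in> graph_ball n p \<eta>" "y - {e} \<in> graph_ball n p \<eta>"
    using y e by (auto intro!: * simp: graph_ball_def[of n p "\<eta> / 2"] graphs_on_def)
qed

section \<open>One step of the coupled dynamics\<close>

text \<open>
  For \<open>x \<subseteq> y\<close> this is a weighted Hamming distance. One weight function serves both the global and the local
  distance.
\<close>
definition discrepancy :: "(nat set \<Rightarrow> real) \<Rightarrow> ngraph \<Rightarrow> ngraph \<Rightarrow> real" where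
  "discrepancy w x y = (\<Sum>e\<in>y - x. w e)"

lemma sum_off_diagonal_swap:
  assumes "finite A" "finite B"
  shows "(\<Sum>a\<in>A. \<Sum>b\<in>B - {a}. f a b) = (\<Sum>b\<in>B. \<Sum>a\<in>A - {b}. f a b)"
proof -
  have "(\<Sum>a\<in>A. \<Sum>b\<in>{b \<in> B. a \<noteq> b}. f a b) = (\<Sum>b\<in>B. \<Sum>a\<in>{a \<in> A. a \<noteq> b}. f a b)"
    using assms by (rule sum.swap_restrict)
  moreover have "{b \<in> B. a \<noteq> b} = B - {a}" "{a \<in> A. a \<noteq> b} = A - {b}" for a b by auto
  ultimately show ?thesis by simp
qed

lemma card_pot_edges: "card (pot_edges n) \<le> n\<^sup>2" "n \<ge> 2 \<Longrightarrow> card (pot_edges n) > 0"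
proof -
  have *: "card (pot_edges n) = n choose 2"
  proof -
    have "pot_edges n = {B. B \<subseteq> {1..n} \<and> card B = 2}"
      by (auto simp: pot_edges_def nsets_def finite_subset)
    then show ?thesis by (simp add: n_subsets)
  qed
  show "card (pot_edges n) > 0" if "n \<ge> 2" using that by (simp add: *)
  show "card (pot_edges n) \<le> n\<^sup>2"
  proof (cases "n \<ge> 2")
    case True then show ?thesis unfolding * by (rule binomial_le_pow)
  qed (simp add: * binomial_eq_0)
qed

text \<open>
  The lower bound on \<open>n\<close> in terms of \<open>\<eta>\<close> ensures that a single flip moves the cut distance by less than
  \<open>\<eta>/2\<close>.
\<close>
locale conditioned_glauber =
  fixes K :: nat and G :: "nat \<Rightarrow> fgraph" and \<beta> :: "nat \<Rightarrow> real" and n :: nat and p \<eta> \<epsilon> :: real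
  assumes ferro: "ferromagnetic_ergm K G \<beta>"
    and p01: "0 \<le> p" "p \<le> 1" and eps: "0 \<le> p - \<epsilon>"
    and eta: "0 < \<eta>" "8 / \<eta> < real n" and n2: "2 \<le> n"
begin

abbreviation step :: "nat set \<times> real \<Rightarrow> ngraph \<Rightarrow> ngraph" where
  "step \<equiv> glauber_step K G \<beta> n p \<eta>"

abbreviation chain :: "ngraph \<Rightarrow> nat \<Rightarrow> (nat set \<times> real) stream \<Rightarrow> ngraph" where
  "chain \<equiv> glauber K G \<beta> n p \<eta>"

abbreviation rate :: "ngraph \<Rightarrow> nat set \<Rightarrow> real" where
  "rate y e \<equiv> logistic (edge_field K G \<beta> n y e)"

definition good :: "ngraph set" where
  "good = Gamma_set K G n p \<epsilon> \<inter> graph_ball n p (\<eta> / 2)"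

definition uniform01 :: "real measure" where
  "uniform01 = uniform_measure lborel {0..1}"

definition draw :: "(nat set \<times> real) measure" where
  "draw = measure_pmf (pmf_of_set (pot_edges n)) \<Otimes>\<^sub>M uniform01"

lemma n_pos: "n > 0" using n2 by simp

lemma step_eq:
  "step (e, u) y =
    (let z = (if u \<le> rate y e then insert e y else y - {e}) in if z \<in> graph_ball n p \<eta> then z else y)"
  by (simp add: glauber_step_def edge_field_def)

lemma step_in_graphs: "y \<in> graphs_on n \<Longrightarrow> step a y \<in> graphs_on n"
  by (cases a) (auto simp: step_eq Let_def graph_ball_def)

lemma good_in_graphs: "y \<in> good \<Longrightarrow> y \<in> graphs_on n" "y \<in> good \<Longrightarrow> y \<subseteq> pot_edges n"
  by (auto simp: good_def Gamma_set_def graphs_on_def)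

lemma finite_graphs_on: "finite (graphs_on n)"
  by (simp add: graphs_on_def finite_pot_edges)

lemma step_accept:
  assumes "y \<in> good" "e \<in> pot_edges n"
  shows "step (e, u) y = (if u \<le> rate y e then insert e y else y - {e})"
  using graph_ball_edge_change[OF p01 n_pos eta(2) eta(1) assms(2)] assms(1)
  by (auto simp: step_eq Let_def good_def)

text \<open>
  The noise space contains pairs whose first component is no potential edge. Such a proposal never changes the
  graph, so that statements about one step hold for every value of the noise and not only almost surely.
\<close>
lemma step_off_edges:
  assumes "y \<in> graphs_on n" "e \<notin> pot_edges n"
  shows "step (e, u) y = y"
proof -
  have "e \<notin> y" using assms by (auto simp: graphs_on_def)
  moreover have "insert e y \<notin> graph_ball n p \<eta>"
    using assms(2) by (auto simp: graph_ball_def graphs_on_def)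
  ultimately show ?thesis by (auto simp: step_eq Let_def)
qed

lemma rate_mono:
  assumes "x \<subseteq> y" "e \<in> pot_edges n"
  shows "rate x e \<le> rate y e"
  using edge_field_mono[OF ferro assms n_pos] by (rule logistic_mono)

lemma step_mono:
  assumes "x \<in> good" "y \<in> good" "x \<subseteq> y"
  shows "step a x \<subseteq> step a y"
proof (cases a)
  case (Pair e u)
  show ?thesis
  proof (cases "e \<in> pot_edges n")
    case True
    then show ?thesis
      using rate_mono[OF assms(3) True] assms by (auto simp: Pair step_accept)
  next
    case False
    then show ?thesis
      using assms good_in_graphs by (simp add: Pair step_off_edges)
  qed
qed

lemma prob_space_uniform01: "prob_space uniform01"
  unfolding uniform01_def by (rule prob_space_uniform_measure) auto

lemma prob_space_draw: "prob_space draw"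
proof -
  interpret U: prob_space uniform01 by (rule prob_space_uniform01)
  interpret P: pair_prob_space "measure_pmf (pmf_of_set (pot_edges n))" uniform01 ..
  show ?thesis unfolding draw_def by (rule P.prob_space_axioms)
qed

lemma measurable_step:
  assumes y: "y \<in> graphs_on n"
  shows "(\<lambda>a. step a y) \<in> draw \<rightarrow>\<^sub>M count_space (graphs_on n)"
proof -
  let ?a = "\<lambda>e. if insert e y \<in> graph_ball n p \<eta> then insert e y else y"
  let ?b = "\<lambda>e. if y - {e} \<in> graph_ball n p \<eta> then y - {e} else y"
  have eq: "(\<lambda>a. step a y) = (\<lambda>a. if snd a \<le> rate y (fst a) then ?a (fst a) else ?b (fst a))"
    by (rule ext, rename_tac a, case_tac a) (simp add: step_eq Let_def)
  have fst: "(\<lambda>a. f (fst a)) \<in> draw \<rightarrow>\<^sub>M N" if "range f \<subseteq> space N" for f and N :: "'b measure"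
    unfolding draw_def by (rule measurable_compose[OF measurable_fst]) (use that in auto)
  have snd: "snd \<in> borel_measurable draw"
  proof -
    have "snd \<in> draw \<rightarrow>\<^sub>M uniform01" unfolding draw_def by (rule measurable_snd)
    moreover have "sets uniform01 = sets borel" by (simp add: uniform01_def)
    ultimately show ?thesis using measurable_cong_sets[OF refl, of uniform01 borel draw] by simp
  qed
  have rate: "(\<lambda>a. rate y (fst a)) \<in> borel_measurable draw"
    by (rule fst) (simp only: space_borel subset_UNIV)
  show ?thesis unfolding eq
  proof (rule measurable_If)
    show "(\<lambda>a. ?a (fst a)) \<in> draw \<rightarrow>\<^sub>M count_space (graphs_on n)"
      using y by (intro fst) (auto simp: graph_ball_def)
    show "(\<lambda>a. ?b (fst a)) \<in> draw \<rightarrow>\<^sub>M count_space (graphs_on n)"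
      using y by (intro fst) (auto simp: graph_ball_def)
    show "{a \<in> space draw. snd a \<le> rate y (fst a)} \<in> sets draw"
      by (rule borel_measurable_le[OF snd rate])
  qed
qed

text \<open>
  The type of graphs is uncountable, but the chains only visit the finitely many graphs on \<open>[n]\<close>; composing
  over this finite set gives measurability.
\<close>
lemma measurable_graph_fun:
  assumes "\<And>x. x \<in> graphs_on n \<Longrightarrow> (\<lambda>a. f x a) \<in> M \<rightarrow>\<^sub>M N" "X \<in> M \<rightarrow>\<^sub>M count_space (graphs_on n)"
  shows "(\<lambda>a. f (X a) a) \<in> M \<rightarrow>\<^sub>M N"
  by (rule measurable_compose_countable'[where f = f and g = X, OF assms(1) assms(2)
        countable_finite[OF finite_graphs_on]])

text \<open>
  After resampling \<open>e\<close> the ordered pair disagrees at \<open>e\<close> exactly if the common uniform variable falls between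
  the two acceptance thresholds.
\<close>
lemma discrepancy_step:
  assumes x: "x \<in> good" and y: "y \<in> good" and xy: "x \<subseteq> y" and e: "e \<in> pot_edges n"
  shows "discrepancy w (step (e, u) x) (step (e, u) y)
     = (\<Sum>f\<in>y - x - {e}. w f) + w e * indicator {rate x e<..rate y e} u"
proof -
  have fin: "finite (y - x)"
    using good_in_graphs(2)[OF y] finite_pot_edges finite_subset by blast
  note le = rate_mono[OF xy e]
  consider "u \<le> rate x e" | "rate x e < u" "u \<le> rate y e" | "rate y e < u" by linarith
  then show ?thesis
  proof cases
    case 1
    have "insert e y - insert e x = y - x - {e}" by auto
    then show ?thesis using 1 le by (simp add: step_accept[OF x e] step_accept[OF y e] discrepancy_def)
  next
    case 2
    have "insert e y - (x - {e}) = insert e (y - x - {e})" by auto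
    then show ?thesis
      using 2 fin by (simp add: step_accept[OF x e] step_accept[OF y e] discrepancy_def sum.insert_remove)
  next
    case 3
    have "y - {e} - (x - {e}) = y - x - {e}" by auto
    then show ?thesis using 3 le by (simp add: step_accept[OF x e] step_accept[OF y e] discrepancy_def)
  qed
qed

lemma nn_integral_threshold:
  assumes "0 \<le> c" "0 \<le> d" "0 \<le> a" "a \<le> b" "b \<le> 1"
  shows "(\<integral>\<^sup>+u. ennreal (c + d * indicator {a<..b} u) \<partial>uniform01) = ennreal (c + d * (b - a))"
proof -
  interpret U: prob_space uniform01 by (rule prob_space_uniform01)
  have "emeasure uniform01 {a<..b} = ennreal (b - a)"
  proof -
    have "{0..1} \<inter> {a<..b} = {a<..b}" using assms by auto
    then show ?thesis using assms divide_ennreal[of "b - a" 1] by (simp add: uniform01_def)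
  qed
  moreover have "ennreal (c + d * indicator {a<..b} u) = ennreal c + ennreal d * indicator {a<..b} u" for u
    using assms by (simp add: indicator_def ennreal_plus)
  moreover have "{a<..b} \<in> sets uniform01" by (simp add: uniform01_def)
  ultimately show ?thesis
    using assms by (simp add: nn_integral_add nn_integral_cmult U.emeasure_space_1 ennreal_plus ennreal_mult)
qed

lemma nn_integral_draw:
  assumes "f \<in> borel_measurable draw"
  shows "(\<integral>\<^sup>+a. f a \<partial>draw) = (\<Sum>e\<in>pot_edges n. \<integral>\<^sup>+u. f (e, u) \<partial>uniform01) / card (pot_edges n)"
proof -
  interpret U: prob_space uniform01 by (rule prob_space_uniform01)
  have ne: "pot_edges n \<noteq> {}" using card_pot_edges(2)[OF n2] by auto
  have "(\<integral>\<^sup>+a. f a \<partial>draw) = (\<integral>\<^sup>+e. \<integral>\<^sup>+u. f (e, u) \<partial>uniform01 \<partial>measure_pmf (pmf_of_set (pot_edges n)))"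
    unfolding draw_def by (rule U.nn_integral_fst[symmetric]) (use assms draw_def in simp)
  then show ?thesis using nn_integral_pmf_of_set[OF ne finite_pot_edges] by simp
qed

text \<open>
  Resampling removes each edge of \<open>y - x\<close> from the discrepancy at rate \<open>1/card (pot_edges n)\<close> and creates new
  disagreements according to the influences. The last hypothesis says that the influence
  matrix, multiplied by \<open>a\<close>, maps the weights to at most \<open>1 - \<delta>\<close> times themselves.
\<close>
lemma expected_discrepancy_step:
  assumes x: "x \<in> good" and y: "y \<in> good" and xy: "x \<subseteq> y" and w: "\<And>e. 0 \<le> w e" and a: "0 \<le> a"
    and slope: "\<And>z. mf_slope K G \<beta> (p - \<epsilon>) \<le> z \<Longrightarrow> z \<le> mf_slope K G \<beta> (p + \<epsilon>) \<Longrightarrow>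
      logistic z * (1 - logistic z) \<le> a"
    and contr: "\<And>e'. e' \<in> y \<Longrightarrow>
      a * (\<Sum>e\<in>pot_edges n - {e'}. w e * pair_influence K G \<beta> n y e e') \<le> (1 - \<delta>) * w e'"
  shows "(\<integral>\<^sup>+d. ennreal (discrepancy w (step d x) (step d y)) \<partial>draw)
    \<le> ennreal ((1 - \<delta> / card (pot_edges n)) * discrepancy w x y)"
proof -
  let ?P = "pot_edges n" and ?J = "pair_influence K G \<beta> n y" and ?D = "discrepancy w x y"
  have finP: "finite ?P" by (rule finite_pot_edges)
  have sub: "y - x \<subseteq> ?P" using good_in_graphs(2)[OF y] by blast
  have fin: "finite (y - x)" using finite_subset[OF sub finP] .
  have Gam: "x \<in> Gamma_set K G n p \<epsilon>" "y \<in> Gamma_set K G n p \<epsilon>" using x y by (auto simp: good_def)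
  define c where "c e = (\<Sum>f\<in>y - x - {e}. w f) + w e * (rate y e - rate x e)" for e
  have c0: "0 \<le> c e" if "e \<in> ?P" for e
    unfolding c_def using w rate_mono[OF xy that] by (intro add_nonneg_nonneg sum_nonneg mult_nonneg_nonneg) auto
  have M: "real (card ?P) > 0" using card_pot_edges(2)[OF n2] by simp
  have "(\<lambda>d. ennreal (discrepancy w x' (step d y))) \<in> borel_measurable draw" for x'
    by (rule measurable_graph_fun[where f = "\<lambda>y' d. ennreal (discrepancy w x' y')",
          OF measurable_const measurable_step[OF good_in_graphs(1)[OF y]]]) simp
  then have "(\<lambda>d. ennreal (discrepancy w (step d x) (step d y))) \<in> borel_measurable draw"
    by (rule measurable_graph_fun[where f = "\<lambda>x' d. ennreal (discrepancy w x' (step d y))" and X = "\<lambda>d. step d x",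
          OF _ measurable_step[OF good_in_graphs(1)[OF x]]])
  then have "(\<integral>\<^sup>+d. ennreal (discrepancy w (step d x) (step d y)) \<partial>draw)
     = (\<Sum>e\<in>?P. \<integral>\<^sup>+u. ennreal (discrepancy w (step (e, u) x) (step (e, u) y)) \<partial>uniform01) / card ?P"
    by (rule nn_integral_draw)
  also have "\<dots> = (\<Sum>e\<in>?P. ennreal (c e)) / card ?P"
  proof (intro arg_cong2[where f = "(/)"] sum.cong refl)
    fix e assume e: "e \<in> ?P"
    show "(\<integral>\<^sup>+u. ennreal (discrepancy w (step (e, u) x) (step (e, u) y)) \<partial>uniform01) = ennreal (c e)"
      unfolding discrepancy_step[OF x y xy e] c_def using w logistic_bounds rate_mono[OF xy e]
      by (intro nn_integral_threshold sum_nonneg) (auto intro: less_imp_le)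
  qed
  also have "\<dots> = ennreal ((\<Sum>e\<in>?P. c e) / card ?P)"
    using c0 M by (simp add: sum_ennreal ennreal_of_nat_eq_real_of_nat divide_ennreal sum_nonneg)
  also have "\<dots> \<le> ennreal ((1 - \<delta> / card ?P) * ?D)"
  proof (rule ennreal_leI)
    have rate_diff: "rate y e - rate x e \<le> a * (\<Sum>e'\<in>y - x - {e}. ?J e e')" if e: "e \<in> ?P" for e
    proof -
      have "rate y e - rate x e \<le> a * (edge_field K G \<beta> n y e - edge_field K G \<beta> n x e)"
        using edge_field_bounds[OF ferro Gam(1) e n_pos eps] edge_field_bounds[OF ferro Gam(2) e n_pos eps]
        by (intro logistic_diff_le edge_field_mono[OF ferro xy e n_pos] slope) auto
      also have "\<dots> \<le> a * (\<Sum>e'\<in>y - x - {e}. ?J e e')"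
        by (intro mult_left_mono edge_field_increment_le[OF ferro xy fin e n_pos] a)
      finally show ?thesis .
    qed
    have "(\<Sum>e\<in>?P. w e * (rate y e - rate x e)) \<le> (\<Sum>e\<in>?P. w e * (a * (\<Sum>e'\<in>y - x - {e}. ?J e e')))"
      using w by (intro sum_mono mult_left_mono rate_diff) auto
    also have "\<dots> = (\<Sum>e\<in>?P. \<Sum>e'\<in>y - x - {e}. a * (w e * ?J e e'))"
      by (simp add: sum_distrib_left ac_simps)
    also have "\<dots> = (\<Sum>e'\<in>y - x. \<Sum>e\<in>?P - {e'}. a * (w e * ?J e e'))"
      by (rule sum_off_diagonal_swap[OF finP fin])
    also have "\<dots> \<le> (\<Sum>e'\<in>y - x. (1 - \<delta>) * w e')"
      using contr by (intro sum_mono) (auto simp: sum_distrib_left)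
    also have "\<dots> = (1 - \<delta>) * ?D" by (simp add: discrepancy_def sum_distrib_left)
    finally have 1: "(\<Sum>e\<in>?P. w e * (rate y e - rate x e)) \<le> (1 - \<delta>) * ?D" .
    \<comment> \<open>Each disagreement survives unless its own edge is drawn.\<close>
    have "(\<Sum>e\<in>?P. \<Sum>f\<in>y - x - {e}. w f) = (\<Sum>f\<in>y - x. \<Sum>e\<in>?P - {f}. w f)"
      by (rule sum_off_diagonal_swap[OF finP fin])
    also have "\<dots> = (\<Sum>f\<in>y - x. (real (card ?P) - 1) * w f)"
    proof (rule sum.cong[OF refl])
      fix f assume "f \<in> y - x"
      then have "f \<in> ?P" using sub by blast
      then have "real (card (?P - {f})) = real (card ?P) - 1"
        using finP M by (simp add: of_nat_diff)
      then show "(\<Sum>e\<in>?P - {f}. w f) = (real (card ?P) - 1) * w f" by simp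
    qed
    also have "\<dots> = (real (card ?P) - 1) * ?D" by (simp add: discrepancy_def sum_distrib_left)
    finally have "(\<Sum>e\<in>?P. c e) \<le> (real (card ?P) - 1) * ?D + (1 - \<delta>) * ?D"
      using 1 by (simp add: c_def sum.distrib)
    also have "\<dots> = (1 - \<delta> / card ?P) * ?D * card ?P" using M by (simp add: field_simps)
    finally show "(\<Sum>e\<in>?P. c e) / card ?P \<le> (1 - \<delta> / card ?P) * ?D"
      using M by (simp add: divide_le_eq)
  qed
  finally show ?thesis .
qed

end

section \<open>Iterating along the noise\<close>

lemma d_Ham_loc_sym: "d_Ham_loc n v x y = d_Ham_loc n v y x"
  by (simp add: d_Ham_loc_def abs_minus_commute)

lemma d_Ham_loc_nonneg: "0 \<le> d_Ham_loc n v x y"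
  by (simp add: d_Ham_loc_def sum_nonneg)

lemma d_Ham_loc_le_square: "d_Ham_loc n v x y \<le> real n ^ 2"
proof -
  have "d_Ham_loc n v x y \<le> (\<Sum>e\<in>{e \<in> pot_edges n. v \<in> e}. 1)"
    unfolding d_Ham_loc_def by (intro sum_mono) (auto simp: indicator_def)
  also have "\<dots> \<le> real (card (pot_edges n))"
    using finite_pot_edges[of n] by (simp add: card_mono)
  also have "\<dots> \<le> real (n\<^sup>2)" using card_pot_edges(1) of_nat_mono by blast
  finally show ?thesis by simp
qed

lemma d_Ham_loc_le_discrepancy:
  assumes "x \<subseteq> y" "y \<subseteq> pot_edges n" "\<And>e. 0 \<le> w e" "\<And>e. v \<in> e \<Longrightarrow> 1 \<le> w e"
  shows "d_Ham_loc n v x y \<le> discrepancy w x y"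
proof -
  let ?E = "{e \<in> pot_edges n. v \<in> e}"
  have fin: "finite (y - x)" "finite ?E"
    using finite_subset[OF assms(2) finite_pot_edges] finite_pot_edges by auto
  have "d_Ham_loc n v x y = (\<Sum>e\<in>?E. if e \<in> y - x then 1 else 0)"
    unfolding d_Ham_loc_def using assms(1) by (intro sum.cong) (auto simp: indicator_def)
  also have "\<dots> = (\<Sum>e\<in>?E \<inter> (y - x). 1)" by (rule sum.inter_restrict[OF fin(2), symmetric])
  also have "\<dots> \<le> (\<Sum>e\<in>?E \<inter> (y - x). w e)" using assms(4) by (intro sum_mono) auto
  also have "\<dots> \<le> (\<Sum>e\<in>y - x. w e)" using fin assms(3) by (intro sum_mono2) auto
  finally show ?thesis by (simp add: discrepancy_def)
qed

context conditioned_glauber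
begin

lemma glauber_noise_eq: "glauber_noise n = stream_space draw"
  by (simp add: glauber_noise_def draw_def uniform01_def)

lemma prob_space_noise: "prob_space (glauber_noise n)"
  unfolding glauber_noise_eq by (rule prob_space.prob_space_stream_space[OF prob_space_draw])

lemma space_noise: "space (glauber_noise n) = UNIV"
  by (simp add: glauber_noise_def space_stream_space space_pair_measure)

lemma chain_in_graphs: "x \<in> graphs_on n \<Longrightarrow> chain x t \<omega> \<in> graphs_on n"
  by (induction t) (auto intro: step_in_graphs)

text \<open>
  The chain applies the noise from the front of the stream, so the first step can be split off; this makes the
  Markov property available through the product structure of the stream space.
\<close>
lemma chain_Stream: "chain x (Suc t) (a ## \<omega>) = chain (step a x) t \<omega>"
  by (induction t) auto

lemma measurable_chain:
  assumes x: "x \<in> graphs_on n"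
  shows "chain x t \<in> glauber_noise n \<rightarrow>\<^sub>M count_space (graphs_on n)"
proof (induction t)
  case 0
  show ?case using x by simp
next
  case (Suc t)
  have "(\<lambda>\<omega>. step (\<omega> !! t) y) \<in> glauber_noise n \<rightarrow>\<^sub>M count_space (graphs_on n)" if "y \<in> graphs_on n" for y
    unfolding glauber_noise_eq by (rule measurable_compose[OF measurable_snth measurable_step[OF that]])
  from measurable_graph_fun[where f = "\<lambda>y \<omega>. step (\<omega> !! t) y" and X = "chain x t", OF this Suc.IH]
  show ?case by (simp only: glauber.simps(2)[abs_def])
qed

lemma measurable_chain_fun:
  assumes "x \<in> graphs_on n" "y \<in> graphs_on n" "range (\<lambda>(x, y). f x y) \<subseteq> space N"
  shows "(\<lambda>\<omega>. f (chain x t \<omega>) (chain y t \<omega>)) \<in> glauber_noise n \<rightarrow>\<^sub>M N"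
proof -
  have "(\<lambda>\<omega>. f x' (chain y t \<omega>)) \<in> glauber_noise n \<rightarrow>\<^sub>M N" for x'
    by (rule measurable_graph_fun[where f = "\<lambda>y' \<omega>. f x' y'", OF measurable_const measurable_chain[OF assms(2)]])
      (use assms(3) in auto)
  then show ?thesis
    by (rule measurable_graph_fun[where f = "\<lambda>x' \<omega>. f x' (chain y t \<omega>)", OF _ measurable_chain[OF assms(1)]])
qed

definition good_until :: "ngraph \<Rightarrow> nat \<Rightarrow> (nat set \<times> real) stream \<Rightarrow> bool" where
  "good_until x t \<omega> \<longleftrightarrow> (\<forall>s<t. chain x s \<omega> \<in> good)"

lemma good_until_Stream:
  "good_until x (Suc t) (a ## \<omega>) \<longleftrightarrow> x \<in> good \<and> good_until (step a x) t \<omega>"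
  unfolding good_until_def All_less_Suc2 by (simp only: chain_Stream glauber.simps(1))

lemma sets_good_until:
  assumes "x \<in> graphs_on n"
  shows "{\<omega>. good_until x t \<omega>} \<in> sets (glauber_noise n)"
proof -
  have "(\<lambda>\<omega>. s < t \<longrightarrow> chain x s \<omega> \<in> good) \<in> glauber_noise n \<rightarrow>\<^sub>M count_space UNIV" for s
    by (rule measurable_chain_fun[OF assms assms, where f = "\<lambda>x _. s < t \<longrightarrow> x \<in> good"])
      (simp only: space_count_space subset_UNIV)
  then have "{\<omega> \<in> space (glauber_noise n). s < t \<longrightarrow> chain x s \<omega> \<in> good} \<in> sets (glauber_noise n)" for s
    by (rule predE)
  from sets.sets_Collect_countable_All[OF this] show ?thesis
    by (simp only: space_noise good_until_def UNIV_I simp_thms)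
qed

lemma chain_mono:
  assumes "x \<subseteq> y" "good_until x t \<omega>" "good_until y t \<omega>"
  shows "chain x t \<omega> \<subseteq> chain y t \<omega>"
  using assms(2,3)
proof (induction t)
  case (Suc t)
  then have "chain x t \<omega> \<in> good" "chain y t \<omega> \<in> good" "chain x t \<omega> \<subseteq> chain y t \<omega>"
    by (simp_all add: good_until_def less_Suc_eq)
  then show ?case unfolding glauber.simps(2) by (rule step_mono)
qed (simp add: assms(1))

lemma chain_coalesced:
  assumes "chain x s \<omega> = chain y s \<omega>" "s \<le> t"
  shows "chain x t \<omega> = chain y t \<omega>"
  using assms(2) by (induction t rule: dec_induct) (simp_all add: assms(1))

text \<open>
  Restricting to the event that both chains have been good so far makes the contraction applicable at every
  step, and the exceptional probability is not accumulated over time: the event only shrinks. The first step is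
  split off, which is why the starting graphs are generalized.
\<close>
lemma expected_discrepancy_chain:
  assumes contr: "\<And>x y. x \<in> good \<Longrightarrow> y \<in> good \<Longrightarrow> x \<subseteq> y \<Longrightarrow>
      (\<integral>\<^sup>+d. ennreal (discrepancy w (step d x) (step d y)) \<partial>draw) \<le> ennreal (\<rho> * discrepancy w x y)"
    and rho: "0 \<le> \<rho>" and xy: "x \<in> graphs_on n" "y \<in> graphs_on n" "x \<subseteq> y"
  shows "(\<integral>\<^sup>+\<omega>. ennreal (discrepancy w (chain x t \<omega>) (chain y t \<omega>))
      * indicator {\<omega>. good_until x t \<omega> \<and> good_until y t \<omega>} \<omega> \<partial>glauber_noise n)
    \<le> ennreal (\<rho> ^ t * discrepancy w x y)"
  using xy
proof (induction t arbitrary: x y)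
  case 0
  interpret N: prob_space "glauber_noise n" by (rule prob_space_noise)
  show ?case by (simp add: good_until_def N.emeasure_space_1)
next
  case (Suc t)
  interpret D: prob_space draw by (rule prob_space_draw)
  let ?F = "\<lambda>t x y \<omega>. ennreal (discrepancy w (chain x t \<omega>) (chain y t \<omega>))
      * indicator {\<omega>. good_until x t \<omega> \<and> good_until y t \<omega>} \<omega>"
  have F: "?F (Suc t) x y (a ## \<omega>) = (if x \<in> good \<and> y \<in> good then ?F t (step a x) (step a y) \<omega> else 0)" for a \<omega>
    unfolding chain_Stream
    by (cases "x \<in> good \<and> y \<in> good") (auto simp: good_until_Stream indicator_def simp del: glauber.simps)
  have "(\<lambda>\<omega>. ennreal (discrepancy w (chain x (Suc t) \<omega>) (chain y (Suc t) \<omega>))) \<in> borel_measurable (glauber_noise n)"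
    by (rule measurable_chain_fun[OF Suc.prems(1,2), where f = "\<lambda>x y. ennreal (discrepancy w x y)"]) simp
  moreover have "{\<omega>. good_until x (Suc t) \<omega> \<and> good_until y (Suc t) \<omega>} \<in> sets (glauber_noise n)"
    using sets.Int[OF sets_good_until[OF Suc.prems(1)] sets_good_until[OF Suc.prems(2)]]
    by (simp add: Collect_conj_eq)
  ultimately have "?F (Suc t) x y \<in> borel_measurable (glauber_noise n)"
    by (intro borel_measurable_times_ennreal borel_measurable_indicator)
  then have eq: "(\<integral>\<^sup>+\<omega>. ?F (Suc t) x y \<omega> \<partial>glauber_noise n)
      = (\<integral>\<^sup>+a. (\<integral>\<^sup>+\<omega>. ?F (Suc t) x y (a ## \<omega>) \<partial>glauber_noise n) \<partial>draw)"
    unfolding glauber_noise_eq by (rule D.nn_integral_stream_space)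
  show ?case
  proof (cases "x \<in> good \<and> y \<in> good")
    case False
    then show ?thesis unfolding eq F if_not_P[OF False] by simp
  next
    case True
    have "(\<integral>\<^sup>+\<omega>. ?F (Suc t) x y \<omega> \<partial>glauber_noise n)
        = (\<integral>\<^sup>+a. (\<integral>\<^sup>+\<omega>. ?F t (step a x) (step a y) \<omega> \<partial>glauber_noise n) \<partial>draw)"
      unfolding eq F if_P[OF True] ..
    also have "\<dots> \<le> (\<integral>\<^sup>+a. ennreal (\<rho> ^ t * discrepancy w (step a x) (step a y)) \<partial>draw)"
      using True Suc.prems by (intro nn_integral_mono Suc.IH step_in_graphs step_mono) auto
    also have "\<dots> = (\<integral>\<^sup>+a. ennreal (\<rho> ^ t) * ennreal (discrepancy w (step a x) (step a y)) \<partial>draw)"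
      using rho by (simp add: ennreal_mult')
    also have "\<dots> = ennreal (\<rho> ^ t) * (\<integral>\<^sup>+a. ennreal (discrepancy w (step a x) (step a y)) \<partial>draw)"
    proof (rule nn_integral_cmult)
      have "(\<lambda>d. ennreal (discrepancy w x' (step d y))) \<in> borel_measurable draw" for x'
        by (rule measurable_graph_fun[where f = "\<lambda>y' d. ennreal (discrepancy w x' y')",
              OF measurable_const measurable_step[OF Suc.prems(2)]]) simp
      then show "(\<lambda>d. ennreal (discrepancy w (step d x) (step d y))) \<in> borel_measurable draw"
        by (rule measurable_graph_fun[where f = "\<lambda>x' d. ennreal (discrepancy w x' (step d y))" and X = "\<lambda>d. step d x",
              OF _ measurable_step[OF Suc.prems(1)]])
    qed
    also have "\<dots> \<le> ennreal (\<rho> ^ t) * ennreal (\<rho> * discrepancy w x y)"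
      using True Suc.prems by (intro mult_left_mono contr) auto
    also have "\<dots> = ennreal (\<rho> ^ Suc t * discrepancy w x y)"
      using rho by (simp add: ennreal_mult'[symmetric] ac_simps)
    finally show ?thesis .
  qed
qed

section \<open>The local distance bound\<close>

text \<open>
  Weight 1 for the local distance at \<open>v\<close>, plus a small multiple of the global distance that pays for the
  influence of edges away from \<open>v\<close> on edges at \<open>v\<close>.
\<close>
definition tilted_weight :: "real \<Rightarrow> nat \<Rightarrow> nat set \<Rightarrow> real" where
  "tilted_weight A v e = (if v \<in> e then 1 else 0) + A / real n"

text \<open>
  The factor \<open>1 - 2 \<delta>\<close> is available for the column sums of the influences and only \<open>1 - \<delta>\<close> is claimed. For an
  edge away from \<open>v\<close> the difference, \<open>\<delta> A / n\<close>, absorbs its influence of order \<open>1/n\<close> on the edges at \<open>v\<close>.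
\<close>
lemma tilted_weight_contraction:
  assumes A: "0 < A" and a: "0 \<le> a" and y: "y \<in> good" and e': "e' \<in> y"
    and contr: "a * (mf_curv K G \<beta> (p + \<epsilon>) + overlap_const K G \<beta> / real n) \<le> 1 - 2 * \<delta>"
    and "0 \<le> \<delta>" and aA: "a * overlap_const K G \<beta> \<le> \<delta> * A"
  shows "a * (\<Sum>e\<in>pot_edges n - {e'}. tilted_weight A v e * pair_influence K G \<beta> n y e e')
    \<le> (1 - \<delta>) * tilted_weight A v e'"
proof -
  let ?J = "\<lambda>e. pair_influence K G \<beta> n y e e'" and ?P = "pot_edges n - {e'}"
  have e'P: "e' \<in> pot_edges n" using good_in_graphs(2)[OF y] e' by blast
  have Gam: "y \<in> Gamma_set K G n p \<epsilon>" using y by (simp add: good_def)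
  have J0: "0 \<le> ?J e" if "e \<in> ?P" for e
    using that by (intro pair_influence_nonneg[OF ferro]) auto
  have finP: "finite ?P" using finite_pot_edges by auto
  have "(\<Sum>e\<in>?P. ?J e) \<le> mf_curv K G \<beta> (p + \<epsilon>) + overlap_const K G \<beta> / real n"
    by (rule sum_pair_influence_column_le[OF ferro Gam e'P e' n_pos eps])
  then have col: "a * (\<Sum>e\<in>?P. ?J e) \<le> 1 - 2 * \<delta>"
    using contr a by (meson mult_left_mono order_trans)
  have "(\<Sum>e\<in>?P. tilted_weight A v e * ?J e)
      = (\<Sum>e\<in>?P. if v \<in> e then ?J e else 0) + A / n * (\<Sum>e\<in>?P. ?J e)"
    by (simp add: tilted_weight_def distrib_right sum.distrib sum_distrib_left if_distrib[of "\<lambda>x. x * _"] cong: if_cong)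
  also have "(\<Sum>e\<in>?P. if v \<in> e then ?J e else 0) = (\<Sum>e\<in>{e \<in> ?P. v \<in> e}. ?J e)"
    by (rule sum.inter_filter[OF finP, symmetric])
  finally have split: "a * (\<Sum>e\<in>?P. tilted_weight A v e * ?J e)
      = a * (\<Sum>e\<in>{e \<in> ?P. v \<in> e}. ?J e) + A / n * (a * (\<Sum>e\<in>?P. ?J e))"
    by (simp add: distrib_left)
  define B where "B = A / n"
  have B: "0 < B" using A n_pos by (simp add: B_def)
  have "B * (a * (\<Sum>e\<in>?P. ?J e)) \<le> B * (1 - 2 * \<delta>)"
    using col B by (intro mult_left_mono) auto
  then have far: "B * (a * (\<Sum>e\<in>?P. ?J e)) \<le> B - 2 * (\<delta> * B)"
    by (simp add: algebra_simps)
  have nonneg: "0 \<le> \<delta> * B" using B \<open>0 \<le> \<delta>\<close> by simp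
  show ?thesis
  proof (cases "v \<in> e'")
    case True
    have "a * (\<Sum>e\<in>{e \<in> ?P. v \<in> e}. ?J e) \<le> a * (\<Sum>e\<in>?P. ?J e)"
      using finP J0 a by (intro mult_left_mono sum_mono2) auto
    moreover have "(1 - \<delta>) * tilted_weight A v e' = 1 - \<delta> + B - \<delta> * B"
      using True by (simp add: tilted_weight_def algebra_simps flip: B_def)
    ultimately show ?thesis using col far nonneg \<open>0 \<le> \<delta>\<close> unfolding split B_def[symmetric] by linarith
  next
    case False
    have at_v: "{e \<in> ?P. v \<in> e} = {e \<in> pot_edges n. v \<in> e}" using False by auto
    have "a * (\<Sum>e\<in>{e \<in> ?P. v \<in> e}. ?J e) \<le> a * (overlap_const K G \<beta> / n)"
      unfolding at_v by (intro mult_left_mono sum_pair_influence_at_vertex_le ferro e'P False n_pos a)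
    also have "\<dots> \<le> \<delta> * B" using divide_right_mono[OF aA, of n] by (simp add: B_def)
    finally have near: "a * (\<Sum>e\<in>{e \<in> ?P. v \<in> e}. ?J e) \<le> \<delta> * B" .
    have "(1 - \<delta>) * tilted_weight A v e' = B - \<delta> * B"
      using False by (simp add: tilted_weight_def algebra_simps flip: B_def)
    then show ?thesis using near far unfolding split B_def[symmetric] by linarith
  qed
qed

text \<open>
  Let \<open>T\<close> be the least natural number not below \<open>R\<close>. Up to time \<open>T\<close> the weighted discrepancy bounds the local
  distance on the good event. Beyond \<open>T\<close> the local distance vanishes if the chains agree at time \<open>T\<close>, and a
  disagreement at \<open>T\<close> has weight at least \<open>A/n\<close>, so Markov's inequality bounds its probability. Off the good
  event the trivial bound \<open>n\<^sup>2\<close> is used.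
\<close>
lemma expected_local_distance_le:
  assumes x: "x \<in> graphs_on n" and y: "y \<in> graphs_on n" and xy: "x \<subseteq> y" "y - x = {e}" and v: "v \<notin> e"
    and A: "0 < A" and a: "0 \<le> a" and \<delta>: "0 \<le> \<delta>" "\<delta> \<le> 1"
    and slope: "\<And>z. mf_slope K G \<beta> (p - \<epsilon>) \<le> z \<Longrightarrow> z \<le> mf_slope K G \<beta> (p + \<epsilon>) \<Longrightarrow>
      logistic z * (1 - logistic z) \<le> a"
    and contr: "a * (mf_curv K G \<beta> (p + \<epsilon>) + overlap_const K G \<beta> / real n) \<le> 1 - 2 * \<delta>"
    and aA: "a * overlap_const K G \<beta> \<le> \<delta> * A"
    and px: "1 - q \<le> \<P>(\<omega> in glauber_noise n. \<forall>s::nat. real s < R \<longrightarrow> chain x s \<omega> \<in> good)"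
    and py: "1 - q \<le> \<P>(\<omega> in glauber_noise n. \<forall>s::nat. real s < R \<longrightarrow> chain y s \<omega> \<in> good)"
    and q: "0 \<le> q"
  shows "(\<integral>\<omega>. d_Ham_loc n v (chain x t \<omega>) (chain y t \<omega>) \<partial>glauber_noise n)
    \<le> A / n + real n ^ 2 * (2 * q + exp (- \<delta> * R / real n ^ 2))"
proof -
  interpret N: prob_space "glauber_noise n" by (rule prob_space_noise)
  let ?w = "tilted_weight A v" and ?M = "card (pot_edges n)"
  let ?\<rho> = "1 - \<delta> / ?M"
  let ?g = "\<lambda>t. {\<omega>. good_until x t \<omega> \<and> good_until y t \<omega>}"
  let ?D = "\<lambda>t \<omega>. discrepancy ?w (chain x t \<omega>) (chain y t \<omega>)"
  have M: "1 \<le> real ?M" "real ?M \<le> real n ^ 2"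
    using card_pot_edges(2)[OF n2] of_nat_mono[OF card_pot_edges(1)[of n], where 'a = real] by simp_all
  have An: "0 < A / n" using A n_pos by simp
  have w0: "0 \<le> ?w e" and wA: "A / n \<le> ?w e" and w1: "v \<in> e \<Longrightarrow> 1 \<le> ?w e" for e
    using An by (auto simp: tilted_weight_def)
  have rho: "0 \<le> ?\<rho>" "?\<rho> \<le> 1" using \<delta> M by (auto simp: field_simps)
  have step: "(\<integral>\<^sup>+d. ennreal (discrepancy ?w (step d x) (step d y)) \<partial>draw) \<le> ennreal (?\<rho> * discrepancy ?w x y)"
    if "x \<in> good" "y \<in> good" "x \<subseteq> y" for x y
    by (rule expected_discrepancy_step[OF that w0 a slope
          tilted_weight_contraction[OF A a that(2) _ contr \<delta>(1) aA]])
  have D0: "discrepancy ?w x y = A / n"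
    using xy(2) v by (simp add: discrepancy_def tilted_weight_def)
  have D: "(\<integral>\<^sup>+\<omega>. ennreal (?D t \<omega>) * indicator (?g t) \<omega> \<partial>glauber_noise n) \<le> ennreal (?\<rho> ^ t * (A / n))" for t
    using expected_discrepancy_chain[OF step rho(1) x y xy(1), of t] D0 by simp
  have g_sets: "?g t \<in> sets (glauber_noise n)" for t
    using sets.Int[OF sets_good_until[OF x] sets_good_until[OF y]] by (simp add: Collect_conj_eq)
  have D_meas: "(\<lambda>\<omega>. ennreal (?D t \<omega>)) \<in> borel_measurable (glauber_noise n)" for t
    by (rule measurable_chain_fun[OF x y, where f = "\<lambda>x y. ennreal (discrepancy ?w x y)"]) simp
  define T where "T = nat \<lceil>R\<rceil>"
  have T: "real s < R" if "s < T" for s using that unfolding T_def by linarith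
  have bad: "N.prob (- ?g t) \<le> 2 * q" if "t \<le> T" for t
  proof -
    have *: "N.prob (- {\<omega>. good_until z t \<omega>}) \<le> q"
      if z: "z \<in> graphs_on n" "1 - q \<le> \<P>(\<omega> in glauber_noise n. \<forall>s::nat. real s < R \<longrightarrow> chain z s \<omega> \<in> good)" for z
    proof -
      have "\<P>(\<omega> in glauber_noise n. \<forall>s::nat. real s < R \<longrightarrow> chain z s \<omega> \<in> good) \<le> N.prob {\<omega>. good_until z t \<omega>}"
        by (rule N.finite_measure_mono[OF _ sets_good_until[OF z(1)]])
          (use T \<open>t \<le> T\<close> in \<open>auto simp: good_until_def\<close>)
      then show ?thesis
        using N.prob_compl[OF sets_good_until[OF z(1), of t]] z(2) by (simp add: space_noise Compl_eq_Diff_UNIV)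
    qed
    have "- ?g t = - {\<omega>. good_until x t \<omega>} \<union> - {\<omega>. good_until y t \<omega>}" by auto
    then have "N.prob (- ?g t) \<le> N.prob (- {\<omega>. good_until x t \<omega>}) + N.prob (- {\<omega>. good_until y t \<omega>})"
      using sets.compl_sets[OF sets_good_until[OF x]] sets.compl_sets[OF sets_good_until[OF y]]
      by (simp add: space_noise Compl_eq_Diff_UNIV measure_Un_le)
    then show ?thesis using *[OF x px] *[OF y py] by linarith
  qed
  have bad': "(\<integral>\<^sup>+\<omega>. ennreal (real n ^ 2) * indicator (- ?g t) \<omega> \<partial>glauber_noise n) \<le> ennreal (real n ^ 2 * (2 * q))"
    if "t \<le> T" for t
  proof -
    have "- ?g t \<in> sets (glauber_noise n)"
      using sets.compl_sets[OF g_sets] by (simp add: space_noise Compl_eq_Diff_UNIV)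
    then have "(\<integral>\<^sup>+\<omega>. ennreal (real n ^ 2) * indicator (- ?g t) \<omega> \<partial>glauber_noise n)
        = ennreal (real n ^ 2) * ennreal (N.prob (- ?g t))"
      by (simp add: nn_integral_cmult N.emeasure_eq_measure)
    also have "\<dots> \<le> ennreal (real n ^ 2) * ennreal (2 * q)"
      by (intro mult_left_mono ennreal_leI bad that) auto
    finally show ?thesis using q by (simp add: ennreal_mult)
  qed
  have ordered: "chain x t \<omega> \<subseteq> chain y t \<omega>" "chain y t \<omega> \<subseteq> pot_edges n" if "\<omega> \<in> ?g t" for t \<omega>
    using that chain_mono[OF xy(1)] chain_in_graphs[OF y] by (auto simp: graphs_on_def)
  have nn: "(\<integral>\<^sup>+\<omega>. ennreal (d_Ham_loc n v (chain x t \<omega>) (chain y t \<omega>)) \<partial>glauber_noise n)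
      \<le> ennreal (A / n + real n ^ 2 * (2 * q + exp (- \<delta> * R / real n ^ 2)))"
  proof (cases "t \<le> T")
    case True
    have "ennreal (d_Ham_loc n v (chain x t \<omega>) (chain y t \<omega>))
        \<le> ennreal (?D t \<omega>) * indicator (?g t) \<omega> + ennreal (real n ^ 2) * indicator (- ?g t) \<omega>" for \<omega>
      using d_Ham_loc_le_discrepancy[OF ordered w0 w1, of \<omega> t] d_Ham_loc_le_square[of n v]
      by (cases "\<omega> \<in> ?g t") (auto intro!: ennreal_leI)
    then have "(\<integral>\<^sup>+\<omega>. ennreal (d_Ham_loc n v (chain x t \<omega>) (chain y t \<omega>)) \<partial>glauber_noise n)
        \<le> (\<integral>\<^sup>+\<omega>. ennreal (?D t \<omega>) * indicator (?g t) \<omega> + ennreal (real n ^ 2) * indicator (- ?g t) \<omega> \<partial>glauber_noise n)"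
      by (intro nn_integral_mono)
    also have "\<dots> = (\<integral>\<^sup>+\<omega>. ennreal (?D t \<omega>) * indicator (?g t) \<omega> \<partial>glauber_noise n)
        + (\<integral>\<^sup>+\<omega>. ennreal (real n ^ 2) * indicator (- ?g t) \<omega> \<partial>glauber_noise n)"
      using D_meas g_sets[of t] sets.compl_sets[OF g_sets[of t]]
      by (intro nn_integral_add borel_measurable_times_ennreal borel_measurable_indicator borel_measurable_const)
        (simp_all add: space_noise Compl_eq_Diff_UNIV)
    also have "\<dots> \<le> ennreal (A / n) + ennreal (real n ^ 2 * (2 * q))"
    proof (intro add_mono bad' True)
      have "?\<rho> ^ t * (A / n) \<le> A / n" using rho An by (intro mult_left_le_one_le power_le_one) auto
      then show "(\<integral>\<^sup>+\<omega>. ennreal (?D t \<omega>) * indicator (?g t) \<omega> \<partial>glauber_noise n) \<le> ennreal (A / n)"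
        using order_trans[OF D[of t] ennreal_leI] by blast
    qed
    also have "\<dots> = ennreal (A / n + real n ^ 2 * (2 * q))" using An q by (simp add: ennreal_plus)
    also have "\<dots> \<le> ennreal (A / n + real n ^ 2 * (2 * q + exp (- \<delta> * R / real n ^ 2)))"
      by (intro ennreal_leI add_left_mono mult_left_mono) auto
    finally show ?thesis .
  next
    case False
    let ?c = "real n ^ 2 * (n / A)"
    have c0: "0 \<le> ?c" using A by simp
    have "ennreal (d_Ham_loc n v (chain x t \<omega>) (chain y t \<omega>))
        \<le> ennreal ?c * (ennreal (?D T \<omega>) * indicator (?g T) \<omega>) + ennreal (real n ^ 2) * indicator (- ?g T) \<omega>" for \<omega>
    proof (cases "\<omega> \<in> ?g T")
      case True
      show ?thesis
      proof (cases "chain x T \<omega> = chain y T \<omega>")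
        case eq: True
        have "chain x t \<omega> = chain y t \<omega>"
          by (rule chain_coalesced[OF eq]) (use \<open>\<not> t \<le> T\<close> in simp)
        then show ?thesis by (simp add: d_Ham_loc_def)
      next
        case neq: False
        obtain f where f: "f \<in> chain y T \<omega> - chain x T \<omega>" using ordered(1)[OF True] neq by blast
        have "finite (chain y T \<omega> - chain x T \<omega>)"
          using finite_subset[OF ordered(2)[OF True] finite_pot_edges] by (rule finite_Diff)
        then have "?w f \<le> ?D T \<omega>" unfolding discrepancy_def using f w0 by (intro member_le_sum) auto
        then have "A / n \<le> ?D T \<omega>" using wA[of f] by linarith
        then have "1 \<le> (n / A) * ?D T \<omega>" using A n_pos by (simp add: field_simps)
        then have "real n ^ 2 * 1 \<le> real n ^ 2 * ((n / A) * ?D T \<omega>)" by (intro mult_left_mono) auto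
        then have "d_Ham_loc n v (chain x t \<omega>) (chain y t \<omega>) \<le> ?c * ?D T \<omega>"
          using d_Ham_loc_le_square[of n v "chain x t \<omega>" "chain y t \<omega>"] by (simp add: mult.assoc)
        then show ?thesis using True c0 by (simp add: ennreal_leI flip: ennreal_mult')
      qed
    next
      case False
      then show ?thesis using d_Ham_loc_le_square[of n v] by (simp add: ennreal_leI)
    qed
    then have "(\<integral>\<^sup>+\<omega>. ennreal (d_Ham_loc n v (chain x t \<omega>) (chain y t \<omega>)) \<partial>glauber_noise n)
        \<le> (\<integral>\<^sup>+\<omega>. ennreal ?c * (ennreal (?D T \<omega>) * indicator (?g T) \<omega>) + ennreal (real n ^ 2) * indicator (- ?g T) \<omega> \<partial>glauber_noise n)"
      by (intro nn_integral_mono)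
    also have "\<dots> = (\<integral>\<^sup>+\<omega>. ennreal ?c * (ennreal (?D T \<omega>) * indicator (?g T) \<omega>) \<partial>glauber_noise n)
        + (\<integral>\<^sup>+\<omega>. ennreal (real n ^ 2) * indicator (- ?g T) \<omega> \<partial>glauber_noise n)"
      using D_meas g_sets[of T] sets.compl_sets[OF g_sets[of T]]
      by (intro nn_integral_add borel_measurable_times_ennreal borel_measurable_indicator borel_measurable_const)
        (simp_all add: space_noise Compl_eq_Diff_UNIV)
    also have "(\<integral>\<^sup>+\<omega>. ennreal ?c * (ennreal (?D T \<omega>) * indicator (?g T) \<omega>) \<partial>glauber_noise n)
        = ennreal ?c * (\<integral>\<^sup>+\<omega>. ennreal (?D T \<omega>) * indicator (?g T) \<omega> \<partial>glauber_noise n)"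
      using D_meas g_sets
      by (intro nn_integral_cmult borel_measurable_times_ennreal borel_measurable_indicator)
    also have "\<dots> + (\<integral>\<^sup>+\<omega>. ennreal (real n ^ 2) * indicator (- ?g T) \<omega> \<partial>glauber_noise n)
        \<le> ennreal ?c * ennreal (?\<rho> ^ T * (A / n)) + ennreal (real n ^ 2 * (2 * q))"
      by (intro add_mono mult_left_mono D bad') auto
    also have "\<dots> = ennreal (?c * (?\<rho> ^ T * (A / n)) + real n ^ 2 * (2 * q))"
    proof -
      have r0: "0 \<le> ?\<rho> ^ T * (A / n)"
        by (rule mult_nonneg_nonneg[OF zero_le_power[OF rho(1)] less_imp_le[OF An]])
      show ?thesis unfolding ennreal_mult[OF c0 r0, symmetric]
        by (rule ennreal_plus[OF mult_nonneg_nonneg[OF c0 r0], symmetric]) (use q in simp)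
    qed
    also have "?c * (?\<rho> ^ T * (A / n)) = real n ^ 2 * ?\<rho> ^ T" using A n_pos by simp
    also have "ennreal (real n ^ 2 * ?\<rho> ^ T + real n ^ 2 * (2 * q))
        \<le> ennreal (A / n + real n ^ 2 * (2 * q + exp (- \<delta> * R / real n ^ 2)))"
    proof (rule ennreal_leI)
      have "?\<rho> ^ T \<le> exp (- \<delta> / ?M) ^ T"
        using rho(1) exp_ge_add_one_self[of "- \<delta> / ?M"] by (intro power_mono) auto
      also have "\<dots> = exp (- (real T * (\<delta> / ?M)))" by (simp add: exp_of_nat_mult[symmetric])
      also have "\<dots> \<le> exp (- \<delta> * R / real n ^ 2)"
      proof -
        have "R * (\<delta> / real n ^ 2) \<le> real T * (\<delta> / real n ^ 2)"
          using \<delta> unfolding T_def by (intro mult_right_mono) (auto intro: of_nat_ceiling)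
        also have "\<dots> \<le> real T * (\<delta> / ?M)"
          using \<delta> M n_pos by (intro mult_left_mono divide_left_mono mult_pos_pos) auto
        finally show ?thesis by (simp add: mult.commute)
      qed
      finally have "real n ^ 2 * ?\<rho> ^ T \<le> real n ^ 2 * exp (- \<delta> * R / real n ^ 2)"
        by (intro mult_left_mono) auto
      then show "real n ^ 2 * ?\<rho> ^ T + real n ^ 2 * (2 * q)
          \<le> A / n + real n ^ 2 * (2 * q + exp (- \<delta> * R / real n ^ 2))"
        using An by (simp add: distrib_left)
    qed
    finally show ?thesis .
  qed
  have "(\<lambda>\<omega>. d_Ham_loc n v (chain x t \<omega>) (chain y t \<omega>)) \<in> borel_measurable (glauber_noise n)"
    by (rule measurable_chain_fun[OF x y]) simp
  then have "(\<integral>\<omega>. d_Ham_loc n v (chain x t \<omega>) (chain y t \<omega>) \<partial>glauber_noise n)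
      = enn2real (\<integral>\<^sup>+\<omega>. ennreal (d_Ham_loc n v (chain x t \<omega>) (chain y t \<omega>)) \<partial>glauber_noise n)"
    by (rule integral_eq_nn_integral) (simp add: d_Ham_loc_nonneg)
  also have "\<dots> \<le> A / n + real n ^ 2 * (2 * q + exp (- \<delta> * R / real n ^ 2))"
    using nn An q by (intro enn2real_leI) auto
  finally show ?thesis .
qed

end

lemma d_Ham_flip_le: "d_Ham n (flip e x) x \<le> 1"
proof -
  have "d_Ham n (flip e x) x \<le> (\<Sum>f\<in>pot_edges n. if f = e then 1 else 0)"
    unfolding d_Ham_def by (intro sum_mono) (auto simp: flip_def indicator_def)
  also have "\<dots> \<le> 1" using finite_pot_edges by (simp add: sum.delta)
  finally show ?thesis .
qed

theorem proposition1p8: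
  fixes K :: nat and G :: "nat \<Rightarrow> fgraph" and \<beta> :: "nat \<Rightarrow> real" and p :: real
  assumes "ferromagnetic_ergm K G \<beta>"
    and "p \<in> U_set K G \<beta>"
  shows "\<exists>\<epsilon>\<^sub>0>0. \<forall>\<epsilon>. 0 < \<epsilon> \<and> \<epsilon> < \<epsilon>\<^sub>0 \<longrightarrow>
    (\<forall>(\<eta>::real) (\<gamma>::real) (\<Lambda> :: nat \<Rightarrow> ngraph set).
      \<eta> > 0 \<and> \<gamma> > 0 \<and> (\<forall>\<^sub>F n in sequentially. is_Lambda_star K G \<beta> n p \<epsilon> \<eta> \<gamma> (\<Lambda> n)) \<longrightarrow>
      (\<exists>C>0. \<forall>\<^sub>F n in sequentially.
        \<forall>v\<in>{1..n}. \<forall>e\<in>pot_edges n. v \<notin> e \<longrightarrow>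
          (\<forall>x\<in>\<Lambda> n. \<forall>t::nat.
            (\<integral>\<omega>. d_Ham_loc n v (glauber K G \<beta> n p \<eta> x t \<omega>)
                               (glauber K G \<beta> n p \<eta> (flip e x) t \<omega>)
               \<partial>(glauber_noise n))
            \<le> C / real n)))"
proof -
  have p01: "0 < p" "p < 1"
    using maximizer_interior[OF assms(1)] assms(2) by (auto simp: U_set_def)
  obtain \<epsilon>\<^sub>0 where \<epsilon>\<^sub>0: "0 < \<epsilon>\<^sub>0" "\<epsilon>\<^sub>0 \<le> p"
    "\<And>\<epsilon>. 0 < \<epsilon> \<Longrightarrow> \<epsilon> < \<epsilon>\<^sub>0 \<Longrightarrow> \<exists>a>0. a * mf_curv K G \<beta> (p + \<epsilon>) < 1 \<and>
      (\<forall>z. mf_slope K G \<beta> (p - \<epsilon>) \<le> z \<and> z \<le> mf_slope K G \<beta> (p + \<epsilon>) \<longrightarrow> logistic z * (1 - logistic z) \<le> a)"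
    using uniform_contraction[OF assms] by blast
  show ?thesis
  proof (rule exI[of _ \<epsilon>\<^sub>0], intro conjI allI impI \<epsilon>\<^sub>0(1))
    fix \<epsilon> \<eta> \<gamma> :: real and \<Lambda> :: "nat \<Rightarrow> ngraph set"
    assume \<epsilon>: "0 < \<epsilon> \<and> \<epsilon> < \<epsilon>\<^sub>0"
      and "\<eta> > 0 \<and> \<gamma> > 0 \<and> (\<forall>\<^sub>F n in sequentially. is_Lambda_star K G \<beta> n p \<epsilon> \<eta> \<gamma> (\<Lambda> n))"
    then have \<eta>: "\<eta> > 0" and \<gamma>: "\<gamma> > 0"
      and \<Lambda>: "\<forall>\<^sub>F n in sequentially. is_Lambda_star K G \<beta> n p \<epsilon> \<eta> \<gamma> (\<Lambda> n)" by auto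
    obtain a where a: "a > 0" "a * mf_curv K G \<beta> (p + \<epsilon>) < 1"
      and slope: "\<And>z. mf_slope K G \<beta> (p - \<epsilon>) \<le> z \<Longrightarrow> z \<le> mf_slope K G \<beta> (p + \<epsilon>) \<Longrightarrow>
        logistic z * (1 - logistic z) \<le> a"
      using \<epsilon>\<^sub>0(3) \<epsilon> by blast
    define c where "c = overlap_const K G \<beta>"
    \<comment> \<open>The gap below 1 is split in four: two parts stay in the column bound \<open>1 - 2 \<delta>\<close>, and the other two
      absorb the \<open>O(1/n)\<close> correction. The added 1 keeps \<open>A\<close> positive if \<open>c = 0\<close>.\<close>
    define \<delta> where "\<delta> = (1 - a * mf_curv K G \<beta> (p + \<epsilon>)) / 4"
    define A where "A = a * c / \<delta> + 1"
    have "0 \<le> a * mf_curv K G \<beta> (p + \<epsilon>)"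
      using a p01 \<epsilon> by (intro mult_nonneg_nonneg mf_curv_nonneg[OF assms(1)]) auto
    then have \<delta>: "0 < \<delta>" "\<delta> \<le> 1" using a by (auto simp: \<delta>_def)
    have c0: "0 \<le> c" by (simp add: c_def overlap_const_def sum_nonneg)
    have A: "0 < A" "a * c \<le> \<delta> * A"
      using a c0 \<delta> by (auto simp: A_def distrib_left intro: add_nonneg_pos)
    have "\<forall>\<^sub>F n in sequentially. 8 / \<eta> < real n"
      by (rule eventually_compose_filterlim[OF eventually_gt_at_top filterlim_real_sequentially])
    moreover have "\<forall>\<^sub>F n in sequentially. a * c / (2 * \<delta>) < real n"
      by (rule eventually_compose_filterlim[OF eventually_gt_at_top filterlim_real_sequentially])
    moreover have "\<forall>\<^sub>F n in sequentially.
        real n ^ 2 * (2 * exp (- \<gamma> * real n) + exp (- \<delta> * exp (\<gamma> * real n) / real n ^ 2)) \<le> 1 / real n"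
      using \<gamma> \<delta>(1) by real_asymp
    ultimately have "\<forall>\<^sub>F n in sequentially. \<forall>v\<in>{1..n}. \<forall>e\<in>pot_edges n. v \<notin> e \<longrightarrow>
          (\<forall>x\<in>\<Lambda> n. \<forall>t::nat.
            (\<integral>\<omega>. d_Ham_loc n v (glauber K G \<beta> n p \<eta> x t \<omega>)
                               (glauber K G \<beta> n p \<eta> (flip e x) t \<omega>)
               \<partial>(glauber_noise n)) \<le> (A + 1) / real n)"
      using \<Lambda> eventually_ge_at_top[of 2]
    proof eventually_elim
      case (elim n)
      interpret conditioned_glauber K G \<beta> n p \<eta> \<epsilon>
        by standard (use assms(1) p01 \<epsilon> \<epsilon>\<^sub>0(2) \<eta> elim in auto)
      have contr: "a * (mf_curv K G \<beta> (p + \<epsilon>) + c / real n) \<le> 1 - 2 * \<delta>"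
      proof -
        have "a * c / real n \<le> 2 * \<delta>" using elim(2) \<delta>(1) n_pos by (simp add: field_simps)
        moreover have "a * mf_curv K G \<beta> (p + \<epsilon>) = 1 - 4 * \<delta>" by (simp add: \<delta>_def field_simps)
        ultimately show ?thesis by (simp add: distrib_left)
      qed
      show ?case
      proof (intro ballI impI allI)
        fix v e x t
        assume e: "e \<in> pot_edges n" and v: "v \<notin> e" and x: "x \<in> \<Lambda> n"
        have xg: "x \<in> graphs_on n" using elim(4) x by (auto simp: is_Lambda_star_def graph_ball_def)
        then have fg: "flip e x \<in> graphs_on n" using e by (auto simp: flip_def graphs_on_def)
        \<comment> \<open>Both starting graphs are within Hamming distance 1 of \<open>\<Lambda> n\<close>.\<close>
        let ?q = "exp (- \<gamma> * real n)" and ?R = "exp (\<gamma> * real n)"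
        have prob: "1 - ?q \<le> \<P>(\<omega> in glauber_noise n. \<forall>s::nat. real s < ?R \<longrightarrow> chain z s \<omega> \<in> good)"
          if "z \<in> graphs_on n" "d_Ham n z x \<le> 1" for z
          using elim(4) x that unfolding is_Lambda_star_def good_def by blast
        have px: "1 - ?q \<le> \<P>(\<omega> in glauber_noise n. \<forall>s::nat. real s < ?R \<longrightarrow> chain x s \<omega> \<in> good)"
          by (rule prob[OF xg]) (simp add: d_Ham_def)
        note pf = prob[OF fg d_Ham_flip_le]
        note bound = expected_local_distance_le[OF _ _ _ _ v A(1) less_imp_le[OF a(1)] less_imp_le[OF \<delta>(1)] \<delta>(2)
            slope contr[unfolded c_def] A(2)[unfolded c_def] _ _ exp_ge_zero]
        have "(\<integral>\<omega>. d_Ham_loc n v (chain x t \<omega>) (chain (flip e x) t \<omega>) \<partial>glauber_noise n)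
            \<le> A / n + real n ^ 2 * (2 * ?q + exp (- \<delta> * ?R / real n ^ 2))"
        proof (cases "e \<in> x")
          case True
          have "flip e x \<subseteq> x" "x - flip e x = {e}" using True by (auto simp: flip_def)
          then have "(\<integral>\<omega>. d_Ham_loc n v (chain (flip e x) t \<omega>) (chain x t \<omega>) \<partial>glauber_noise n)
            \<le> A / n + real n ^ 2 * (2 * ?q + exp (- \<delta> * ?R / real n ^ 2))"
            by (rule bound[OF fg xg _ _ _ _ pf px])
          moreover have "(\<lambda>\<omega>. d_Ham_loc n v (chain x t \<omega>) (chain (flip e x) t \<omega>))
              = (\<lambda>\<omega>. d_Ham_loc n v (chain (flip e x) t \<omega>) (chain x t \<omega>))"
            by (rule ext) (rule d_Ham_loc_sym)
          ultimately show ?thesis by (simp only:)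
        next
          case False
          have "x \<subseteq> flip e x" "flip e x - x = {e}" using False by (auto simp: flip_def)
          then show ?thesis by (rule bound[OF xg fg _ _ _ _ px pf])
        qed
        also have "\<dots> \<le> A / n + 1 / n" using elim(3) by (intro add_left_mono)
        finally show "(\<integral>\<omega>. d_Ham_loc n v (chain x t \<omega>) (chain (flip e x) t \<omega>) \<partial>glauber_noise n)
            \<le> (A + 1) / n" by (simp add: add_divide_distrib)
      qed
    qed
    then show "\<exists>C>0. \<forall>\<^sub>F n in sequentially. \<forall>v\<in>{1..n}. \<forall>e\<in>pot_edges n. v \<notin> e \<longrightarrow>
          (\<forall>x\<in>\<Lambda> n. \<forall>t::nat.
            (\<integral>\<omega>. d_Ham_loc n v (glauber K G \<beta> n p \<eta> x t \<omega>)
                               (glauber K G \<beta> n p \<eta> (flip e x) t \<omega>)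
               \<partial>(glauber_noise n)) \<le> C / real n)"
      using A(1) by (intro exI[of _ "A + 1"]) simp
  qed
qed

end
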